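(* Let $r\ge 1$ and let $P^{\mathrm{ROT}^r}_{X,Y}$ be the randomized Rabin oblivious transfer of $r$-bit strings. Then every embedding of $P^{\mathrm{ROT}^r}_{X,Y}$ has leakage at least $1-O(r2^{-r})$ (i.e. there is a constant $C$ such that for all $r$ the leakage is at least $1-Cr2^{-r}$); for $r=1$ every embedding has leakage at least $h(\tfrac14)-\tfrac12\approx0.311$. Furthermore, the leakage is the same for all embeddings of $P^{\mathrm{ROT}^r}_{X,Y}$.
   Context: $P^{\mathrm{ROT}^r}_{X,Y}$ is the distribution on $x\in\{0,1\}^r$, $y\in\{0,1\}^r\cup\{\bot\}$ given by $P(x,y)=2^{-r-1}$ if $y=x$ or $y=\bot$, and $0$ otherwise. $h$ is the binary entropy function (base 2). For a primitive $P_{X,Y}$ on finite sets $\mathcal X\times\mathcal Y$: $\mathcal H_A,\mathcal H_B$ have computational bases indexed by $\mathcal X,\mathcal Y$; $\mathcal H_{A'},\mathcal H_{B'}$ are finite-dimensional (possibly trivial) work spaces; for a pure state on $AA'BB'$, $X$ (resp. $Y$) is the outcome of measuring $A$ (resp. $B$) in the computational basis; entropic quantities are evaluated on the state obtained by measuring exactly the registers named by $X$ or $Y$ and tracing out unmentioned registers; $S(P;Q)=S(P)+S(Q)-S(PQ)$ (von Neumann); $I$ is Shannon mutual information. An embedding of $P_{X,Y}$ is a pure state with $(X,Y)\sim P_{X,Y}$ and $S(X;YB')=S(XA';Y)=I(X;Y)$; its leakage is $\Delta_\psi(P_{X,Y})=\max\{S(X;BB')-I(X;Y),S(AA';Y)-I(X;Y)\}$.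 *)

theory Defs
  imports Complex_Main "Jordan_Normal_Form.Char_Poly"
begin

text \<open>Registers of a multi-register system are numbered 0..n-1, with local dimensions
  given by a list dims. A basis vector of the whole system is a list ks of length n with
  ks!j < dims!j. A (vector) state is a function from such lists to amplitudes.
  For the embedding problem: register 0 = A, 1 = A', 2 = B, 3 = B'.\<close>

definition eta :: "real \<Rightarrow> real" where
  "eta p = (if p \<le> 0 then 0 else - p * log 2 p)"

definition sub_basis :: "nat list \<Rightarrow> nat set \<Rightarrow> nat list set" where
  "sub_basis dims K = {ks. length ks = length dims \<and>
      (\<forall>j<length dims. (j \<in> K \<longrightarrow> ks!j < dims!j) \<and> (j \<notin> K \<longrightarrow> ks!j = 0))}"

definition merge_regs :: "nat set \<Rightarrow> nat list \<Rightarrow> nat list \<Rightarrow> nat list" where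
  "merge_regs K ks ts = map (\<lambda>j. if j \<in> K then ks!j else ts!j) [0..<length ks]"

text \<open>Operator (density matrix) of the state obtained from the pure state psi by measuring
  the registers M in the computational basis and tracing out all registers not in K
  (M \<subseteq> K are the measured registers that are kept, as classical registers).\<close>
definition reduced_op :: "(nat list \<Rightarrow> complex) \<Rightarrow> nat list \<Rightarrow> nat set \<Rightarrow> nat set
    \<Rightarrow> nat list \<Rightarrow> nat list \<Rightarrow> complex" where
  "reduced_op psi dims K M ks ks' =
     (if (\<forall>j\<in>M. ks!j = ks'!j)
      then (\<Sum>ts\<in>sub_basis dims ({..<length dims} - K).
              psi (merge_regs K ks ts) * cnj (psi (merge_regs K ks' ts)))
      else 0)"

definition op_matrix :: "'i set \<Rightarrow> ('i \<Rightarrow> 'i \<Rightarrow> complex) \<Rightarrow> complex mat" where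
  "op_matrix I rho = (let n = card I; f = (SOME f. bij_betw f {..<n} I)
                       in mat n n (\<lambda>(i, j). rho (f i) (f j)))"

definition vn_entropy :: "'i set \<Rightarrow> ('i \<Rightarrow> 'i \<Rightarrow> complex) \<Rightarrow> real" where
  "vn_entropy I rho = (let p = char_poly (op_matrix I rho) in
      (\<Sum>z\<in>{z. poly p z = 0}. real (order z p) * eta (Re z)))"

definition ent :: "(nat list \<Rightarrow> complex) \<Rightarrow> nat list \<Rightarrow> nat set \<Rightarrow> nat set \<Rightarrow> real" where
  "ent psi dims K M = vn_entropy (sub_basis dims K) (reduced_op psi dims K M)"

definition qmi :: "(nat list \<Rightarrow> complex) \<Rightarrow> nat list \<Rightarrow> nat set \<Rightarrow> nat set
    \<Rightarrow> nat set \<Rightarrow> nat set \<Rightarrow> real" where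
  "qmi psi dims K1 M1 K2 M2 =
     ent psi dims K1 M1 + ent psi dims K2 M2 - ent psi dims (K1 \<union> K2) (M1 \<union> M2)"

definition shannon_mi :: "nat \<Rightarrow> nat \<Rightarrow> (nat \<Rightarrow> nat \<Rightarrow> real) \<Rightarrow> real" where
  "shannon_mi nx ny P =
     (\<Sum>x<nx. eta (\<Sum>y<ny. P x y)) + (\<Sum>y<ny. eta (\<Sum>x<nx. P x y))
     - (\<Sum>x<nx. \<Sum>y<ny. eta (P x y))"

text \<open>Randomized Rabin OT of r-bit strings. x \<in> {0,1}^r is encoded as the number x < 2^r
  (binary expansion); y \<in> {0,1}^r \<union> {\<bottom>} as y < 2^r + 1 with \<bottom> encoded as 2^r.\<close>
definition rot :: "nat \<Rightarrow> nat \<Rightarrow> nat \<Rightarrow> real" where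
  "rot r x y = (if x < 2^r \<and> (y = x \<or> y = 2^r) then 1 / 2^(r+1) else 0)"

definition rot_dims :: "nat \<Rightarrow> nat \<Rightarrow> nat \<Rightarrow> nat list" where
  "rot_dims r da db = [2^r, da, 2^r + 1, db]"

text \<open>Embedding of a primitive P (on {..<nx} \<times> {..<ny}) with work spaces A', B' of
  dimensions da, db \<ge> 1 (dimension 1 = trivial space): a normalized pure state psi
  on A A' B B' with (X,Y) ~ P and S(X;YB') = S(XA';Y) = I(X;Y).\<close>
definition is_embedding :: "nat \<Rightarrow> nat \<Rightarrow> (nat \<Rightarrow> nat \<Rightarrow> real) \<Rightarrow> nat \<Rightarrow> nat
    \<Rightarrow> (nat list \<Rightarrow> complex) \<Rightarrow> bool" where
  "is_embedding nx ny P da db psi \<longleftrightarrow>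
     da \<ge> 1 \<and> db \<ge> 1 \<and>
     (\<Sum>ks\<in>sub_basis [nx, da, ny, db] {0,1,2,3}. (cmod (psi ks))\<^sup>2) = 1 \<and>
     (\<forall>x<nx. \<forall>y<ny. (\<Sum>a<da. \<Sum>b<db. (cmod (psi [x, a, y, b]))\<^sup>2) = P x y) \<and>
     qmi psi [nx, da, ny, db] {0} {0} {2,3} {2} = shannon_mi nx ny P \<and>
     qmi psi [nx, da, ny, db] {0,1} {0} {2} {2} = shannon_mi nx ny P"

definition leakage :: "nat \<Rightarrow> nat \<Rightarrow> (nat \<Rightarrow> nat \<Rightarrow> real) \<Rightarrow> nat \<Rightarrow> nat
    \<Rightarrow> (nat list \<Rightarrow> complex) \<Rightarrow> real" where
  "leakage nx ny P da db psi =
     max (qmi psi [nx, da, ny, db] {0} {0} {2,3} {} - shannon_mi nx ny P)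
         (qmi psi [nx, da, ny, db] {0,1} {} {2} {2} - shannon_mi nx ny P)"

definition binent :: "real \<Rightarrow> real" where
  "binent p = eta p + eta (1 - p)"

end

theory Submission
  imports Defs "Jordan_Normal_Form.Determinant"
begin

text \<open>Let \<open>N = 2 ^ r\<close>, and write \<open>\<Phi>\<^sub>x\<close>, \<open>\<Theta>\<^sub>x\<close> for the matrices of amplitudes
  \<open>psi [x, a, y, b]\<close> (rows \<open>a\<close>, columns \<open>b\<close>) at \<open>y = \<bottom>\<close> and at \<open>y = x\<close>. The two entropy
  conditions of an embedding are equality cases of the bound
  \<open>\<Sum>k\<in>K. S(R\<^sub>k) \<le> S(\<Sum>k\<in>K. R\<^sub>k) + log |K| tr(\<Sum>k\<in>K. R\<^sub>k)\<close> for positive semidefinite \<open>R\<^sub>k\<close>,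
  in which all \<open>R\<^sub>k\<close> coincide. They say that the reduced state \<open>\<Sigma>\<close> of \<open>\<Phi>\<^sub>x\<close> on Bob's
  side does not depend on \<open>x\<close>, and that \<open>\<Theta>\<^sub>x\<close> and \<open>\<Phi>\<^sub>x\<close> have the same reduced state on
  Alice's side. The state of Alice then has the blocks \<open>(1 + \<delta>\<^sub>x\<^sub>x\<^sub>') \<Phi>\<^sub>x \<Phi>\<^sub>x\<^sub>'\<^sup>*\<close>; since
  \<open>A B\<close> and \<open>B A\<close> have the same nonzero spectrum, its spectrum is that of \<open>(I + J) \<otimes> \<Sigma>\<close>, with
  \<open>J\<close> the all-ones matrix, so the entropies of \<open>\<Sigma>\<close> cancel and both terms of the leakage equal
  \<open>1 + r/2 - (N + 1) log (N + 1) / (2 N)\<close>.\<close>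

subsection \<open>Entropy and characteristic polynomials\<close>

text \<open>\<open>vn_entropy\<close> sees an operator only through its characteristic polynomial.
  Stated for arbitrary polynomials, the sum can also be evaluated on factors such as powers of the
  variable.\<close>

definition root_entropy :: "complex poly \<Rightarrow> real" where
  "root_entropy p = (\<Sum>z\<in>{z. poly p z = 0}. real (order z p) * eta (Re z))"

lemma vn_entropy_root_entropy: "vn_entropy I rho = root_entropy (char_poly (op_matrix I rho))"
  by (simp add: vn_entropy_def root_entropy_def Let_def)

text \<open>Points that are not roots have order 0. This lets both factors of a product be summed
  over the roots of the product.\<close>

lemma root_entropy_superset:
  assumes "p \<noteq> 0" "finite R" "{z. poly p z = 0} \<subseteq> R"
  shows "root_entropy p = (\<Sum>z\<in>R. real (order z p) * eta (Re z))"
  unfolding root_entropy_def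
  by (rule sum.mono_neutral_left) (use assms in \<open>auto simp: order_0I\<close>)

lemma root_entropy_mult:
  assumes "p \<noteq> 0" "q \<noteq> 0"
  shows "root_entropy (p * q) = root_entropy p + root_entropy q"
proof -
  have pq: "p * q \<noteq> 0" using assms by simp
  let ?R = "{z. poly (p * q) z = 0}"
  have fin: "finite ?R" using pq by (rule poly_roots_finite)
  have "root_entropy (p * q) = (\<Sum>z\<in>?R. real (order z (p * q)) * eta (Re z))"
    by (simp add: root_entropy_def)
  also have "\<dots> = (\<Sum>z\<in>?R. real (order z p) * eta (Re z)) + (\<Sum>z\<in>?R. real (order z q) * eta (Re z))"
    by (simp add: order_mult[OF pq] ring_distribs sum.distrib del: poly_mult mult_eq_0_iff)
  also have "(\<Sum>z\<in>?R. real (order z p) * eta (Re z)) = root_entropy p"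
    by (rule root_entropy_superset[symmetric]) (use assms fin in auto)
  also have "(\<Sum>z\<in>?R. real (order z q) * eta (Re z)) = root_entropy q"
    by (rule root_entropy_superset[symmetric]) (use assms fin in auto)
  finally show ?thesis .
qed

text \<open>The only possible root is 0, where \<open>eta\<close> vanishes. Padding a spectrum with
  zeros therefore leaves the entropy unchanged.\<close>

lemma root_entropy_X_power: "root_entropy ([:0, 1:] ^ k) = 0"
proof -
  have "root_entropy ([:0, 1:] ^ k) = (\<Sum>z\<in>{0}. real (order z ([:0, 1:] ^ k)) * eta (Re z))"
    by (rule root_entropy_superset) auto
  then show ?thesis by (simp add: eta_def)
qed

lemma root_entropy_linear: "root_entropy [:- c, 1:] = eta (Re c)"
proof -
  have "{z. poly [:- c, 1:] z = 0} = {c}" by auto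
  moreover have "order c [:- c, 1:] = 1"
    using order_power_n_n[of c 1] by simp
  ultimately show ?thesis by (simp add: root_entropy_def)
qed

lemma char_poly_nonzero: "A \<in> carrier_mat n n \<Longrightarrow> char_poly A \<noteq> (0 :: 'a :: idom poly)"
  using degree_monic_char_poly[of A n] by auto

section \<open>Characteristic polynomials of block matrices and of products\<close>

lemma char_poly_four_block_upper_right_zero:
  fixes A :: "'a :: idom mat"
  assumes A: "A \<in> carrier_mat m m" and C: "C \<in> carrier_mat n m" and D: "D \<in> carrier_mat n n"
  shows "char_poly (four_block_mat A (0\<^sub>m m n) C D) = char_poly A * char_poly D"
proof -
  let ?cm = "\<lambda> A. [:0, 1:] \<cdot>\<^sub>m 1\<^sub>m (dim_row A) + map_mat (\<lambda>a. [:- a:]) A"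
  have "char_poly (four_block_mat A (0\<^sub>m m n) C D) = det (?cm (four_block_mat A (0\<^sub>m m n) C D))"
    unfolding char_poly_defs using A C D by simp
  also have "?cm (four_block_mat A (0\<^sub>m m n) C D) =
      four_block_mat (?cm A) (0\<^sub>m m n) (map_mat (\<lambda>a. [:- a:]) C) (?cm D)"
    by (rule eq_matI) (use A C D in auto)
  also have "det \<dots> = det (?cm A) * det (?cm D)"
    by (rule det_four_block_mat_upper_right_zero[OF _ refl]) (use A C D in auto)
  finally show ?thesis unfolding char_poly_defs .
qed

lemma char_poly_zero_mat: "char_poly (0\<^sub>m n n :: 'a :: idom mat) = [:0, 1:] ^ n"
proof -
  have "char_poly (0\<^sub>m n n :: 'a mat) = (\<Prod>a\<leftarrow>diag_mat (0\<^sub>m n n :: 'a mat). [:- a, 1:])"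
    by (rule char_poly_upper_triangular[of _ n]) auto
  also have "\<dots> = [:0, 1:] ^ n"
  proof -
    have "diag_mat (0\<^sub>m n n :: 'a mat) = replicate n 0"
      by (intro nth_equalityI) (auto simp: diag_mat_def)
    then show ?thesis by (simp add: prod_list_replicate)
  qed
  finally show ?thesis .
qed

text \<open>The unipotent block matrix \<open>?X\<close>, with inverse \<open>?Y\<close>, conjugates
  \<open>?M\<close> into \<open>?N\<close>. Both are block triangular, with diagonal blocks
  \<open>A * B\<close>, 0 and 0, \<open>B * A\<close>; the powers of the variable come from the zero
  blocks.\<close>

lemma char_poly_mult_commute:
  fixes A :: "'a :: idom mat"
  assumes A: "A \<in> carrier_mat m n" and B: "B \<in> carrier_mat n m"
  shows "char_poly (A * B) * [:0, 1:] ^ n = [:0, 1:] ^ m * char_poly (B * A)"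
proof -
  let ?M = "four_block_mat (A * B) (0\<^sub>m m n) B (0\<^sub>m n n)"
  let ?N = "four_block_mat (0\<^sub>m m m) (0\<^sub>m m n) B (B * A)"
  let ?X = "four_block_mat (1\<^sub>m m) A (0\<^sub>m n m) (1\<^sub>m n)"
  let ?Y = "four_block_mat (1\<^sub>m m) (- A) (0\<^sub>m n m) (1\<^sub>m n)"
  note car = A B
  have X: "?X \<in> carrier_mat (m + n) (m + n)" and Y: "?Y \<in> carrier_mat (m + n) (m + n)"
    and M: "?M \<in> carrier_mat (m + n) (m + n)" and N: "?N \<in> carrier_mat (m + n) (m + n)"
    using car by auto
  have one: "1\<^sub>m (m + n) = (four_block_mat (1\<^sub>m m) (0\<^sub>m m n) (0\<^sub>m n m) (1\<^sub>m n) :: 'a mat)"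
    by (rule eq_matI) auto
  have XY: "?X * ?Y = 1\<^sub>m (m + n)"
    unfolding one using car
    by (subst mult_four_block_mat[of _ m m _ n _ n _ _ m _ n])
       (auto intro!: eq_matI)
  have YX: "?Y * ?X = 1\<^sub>m (m + n)"
    unfolding one using car
    by (subst mult_four_block_mat[of _ m m _ n _ n _ _ m _ n])
       (auto intro!: eq_matI)
  have MX: "?M * ?X = four_block_mat (A * B) (A * B * A) B (B * A)"
    using car
    by (subst mult_four_block_mat[of _ m m _ n _ n _ _ m _ n]) auto
  have XN: "?X * ?N = four_block_mat (A * B) (A * B * A) B (B * A)"
    using car
    by (subst mult_four_block_mat[of _ m m _ n _ n _ _ m _ n]) auto
  have "?M = ?M * (?X * ?Y)" unfolding XY using right_mult_one_mat[OF M] by simp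
  also have "\<dots> = ?X * ?N * ?Y" using assoc_mult_mat[OF M X Y] MX XN by simp
  finally have "similar_mat_wit ?M ?N ?X ?Y"
    by (intro similar_mat_witI[OF XY YX _ M N X Y])
  then have "char_poly ?M = char_poly ?N"
    by (intro char_poly_similar) (auto simp: similar_mat_def)
  moreover have "char_poly ?M = char_poly (A * B) * [:0, 1:] ^ n"
    using car by (subst char_poly_four_block_upper_right_zero) (auto simp: char_poly_zero_mat)
  moreover have "char_poly ?N = [:0, 1:] ^ m * char_poly (B * A)"
    using car by (subst char_poly_four_block_upper_right_zero) (auto simp: char_poly_zero_mat)
  ultimately show ?thesis by simp
qed

text \<open>The nonzero spectra agree with multiplicities, and the surplus zeros carry no entropy.
  The changes of index set below rest on this.\<close>

lemma root_entropy_mult_commute: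
  assumes A: "A \<in> carrier_mat m n" and B: "B \<in> carrier_mat n m"
  shows "root_entropy (char_poly (A * B)) = root_entropy (char_poly (B * A))"
proof -
  have "char_poly (A * B) \<noteq> 0" "char_poly (B * A) \<noteq> 0"
    using A B by (auto intro!: char_poly_nonzero)
  then have "root_entropy (char_poly (A * B) * [:0, 1:] ^ n) = root_entropy (char_poly (A * B))"
    "root_entropy ([:0, 1:] ^ m * char_poly (B * A)) = root_entropy (char_poly (B * A))"
    by (simp_all add: root_entropy_mult root_entropy_X_power del: pCons_one)
  then show ?thesis using char_poly_mult_commute[OF A B] by simp
qed

section \<open>Entropy of operators on arbitrary finite index sets\<close>

text \<open>\<open>op_matrix\<close> fixes its enumeration by a choice operator; here the
  enumeration is a parameter, so that matrices of a convenient shape can be built.\<close>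

definition enum_mat :: "(nat \<Rightarrow> 'i) \<Rightarrow> nat \<Rightarrow> ('i \<Rightarrow> 'i \<Rightarrow> complex) \<Rightarrow> complex mat" where
  "enum_mat f n rho = mat n n (\<lambda>(i, j). rho (f i) (f j))"

lemma enum_mat_carrier [simp]: "enum_mat f n rho \<in> carrier_mat n n"
  by (simp add: enum_mat_def)

lemma op_matrix_enum:
  assumes "finite I"
  obtains f where "bij_betw f {..<card I} I" "\<And>rho. op_matrix I rho = enum_mat f (card I) rho"
proof
  let ?f = "SOME f. bij_betw f {..<card I} I"
  have "\<exists>f. bij_betw f {..<card I} I"
    using ex_bij_betw_nat_finite[OF assms] by (simp add: atLeast0LessThan)
  then show "bij_betw ?f {..<card I} I" by (rule someI_ex)
  show "op_matrix I rho = enum_mat ?f (card I) rho" for rho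
    by (simp add: op_matrix_def enum_mat_def Let_def)
qed

lemma root_entropy_enum_factor:
  assumes f: "bij_betw f {..<m} I" and g: "bij_betw g {..<n} J"
    and rho: "\<And>i i'. i \<in> I \<Longrightarrow> i' \<in> I \<Longrightarrow> rho i i' = (\<Sum>j\<in>J. A i j * B j i')"
    and tau: "\<And>j j'. j \<in> J \<Longrightarrow> j' \<in> J \<Longrightarrow> tau j j' = (\<Sum>i\<in>I. B j i * A i j')"
  shows "root_entropy (char_poly (enum_mat f m rho)) = root_entropy (char_poly (enum_mat g n tau))"
proof -
  let ?A = "mat m n (\<lambda>(i, j). A (f i) (g j))" and ?B = "mat n m (\<lambda>(j, i). B (g j) (f i))"
  have fI: "f i \<in> I" if "i < m" for i using f that by (auto simp: bij_betw_def)
  have gJ: "g j \<in> J" if "j < n" for j using g that by (auto simp: bij_betw_def)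
  have "enum_mat f m rho = ?A * ?B"
    by (rule eq_matI)
       (auto simp: enum_mat_def scalar_prod_def rho fI sum.reindex_bij_betw[OF g, symmetric]
          atLeast0LessThan)
  moreover have "enum_mat g n tau = ?B * ?A"
    by (rule eq_matI)
       (auto simp: enum_mat_def scalar_prod_def tau gJ sum.reindex_bij_betw[OF f, symmetric]
          atLeast0LessThan)
  ultimately show ?thesis
    using root_entropy_mult_commute[of ?A m n ?B] by simp
qed

text \<open>Any enumeration may replace the chosen one: \<open>rho\<close> is factored as
  \<open>rho\<close> times the identity, and the product in the opposite order is read in the other
  enumeration.\<close>

lemma vn_entropy_enum:
  assumes "finite I" and f: "bij_betw f {..<n} I"
  shows "vn_entropy I rho = root_entropy (char_poly (enum_mat f n rho))"
proof -
  obtain g where g: "bij_betw g {..<card I} I"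
    and op: "op_matrix I rho = enum_mat g (card I) rho"
    using op_matrix_enum[OF assms(1)] by metis
  have "root_entropy (char_poly (enum_mat g (card I) rho)) = root_entropy (char_poly (enum_mat f n rho))"
    by (rule root_entropy_enum_factor[OF g f, of _ rho "\<lambda>i j. if i = j then 1 else 0"])
       (auto simp: assms(1) if_distrib if_distribR cong: if_cong)
  then show ?thesis by (simp add: vn_entropy_root_entropy op)
qed

lemma vn_entropy_cong:
  assumes "finite I" "\<And>i i'. i \<in> I \<Longrightarrow> i' \<in> I \<Longrightarrow> rho i i' = tau i i'"
  shows "vn_entropy I rho = vn_entropy I tau"
proof -
  obtain f where f: "bij_betw f {..<card I} I"
    and op: "op_matrix I rho = enum_mat f (card I) rho" "op_matrix I tau = enum_mat f (card I) tau"
    using op_matrix_enum[OF assms(1)] by metis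
  have "enum_mat f (card I) rho = enum_mat f (card I) tau"
    unfolding enum_mat_def using f assms(2) by (intro eq_matI) (auto simp: bij_betw_def)
  then show ?thesis by (simp add: vn_entropy_root_entropy op)
qed

text \<open>The exchange of \<open>A B\<close> and \<open>B A\<close> in terms of kernels, where the
  two index sets may differ in size and type.\<close>

lemma vn_entropy_factor:
  assumes "finite I" "finite J"
    and "\<And>i i'. i \<in> I \<Longrightarrow> i' \<in> I \<Longrightarrow> rho i i' = (\<Sum>j\<in>J. A i j * B j i')"
    and "\<And>j j'. j \<in> J \<Longrightarrow> j' \<in> J \<Longrightarrow> tau j j' = (\<Sum>i\<in>I. B j i * A i j')"
  shows "vn_entropy I rho = vn_entropy J tau"
proof -
  obtain f where f: "bij_betw f {..<card I} I"
    and op: "op_matrix I rho = enum_mat f (card I) rho"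
    using op_matrix_enum[OF assms(1)] by metis
  obtain g where g: "bij_betw g {..<card J} J"
    and op': "op_matrix J tau = enum_mat g (card J) tau"
    using op_matrix_enum[OF assms(2)] by metis
  show ?thesis
    using root_entropy_enum_factor[OF f g, of rho A B tau] assms(3,4)
    by (simp add: vn_entropy_root_entropy op op')
qed

text \<open>A factorization whose second factor is the permutation matrix of
  \<open>g\<close>.\<close>

lemma vn_entropy_reindex:
  assumes "finite J" and g: "bij_betw g J I"
  shows "vn_entropy I rho = vn_entropy J (\<lambda>j j'. rho (g j) (g j'))"
proof -
  have "finite I" using assms bij_betw_finite by blast
  have inj: "inj_on g J" and I: "I = g ` J" using g by (auto simp: bij_betw_def)
  show ?thesis
  proof (rule vn_entropy_factor[where A = "\<lambda>i j. rho i (g j)" and B = "\<lambda>j i. if g j = i then 1 else 0"])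
    show "rho i i' = (\<Sum>j\<in>J. rho i (g j) * (if g j = i' then 1 else 0))"
      if i: "i \<in> I" "i' \<in> I" for i i'
    proof -
      have "(\<Sum>j\<in>J. rho i (g j) * (if g j = i' then 1 else 0)) = (\<Sum>k\<in>I. rho i k * (if k = i' then 1 else 0))"
        using sum.reindex_bij_betw[OF g, of "\<lambda>k. rho i k * (if k = i' then 1 else 0)"] by simp
      then show ?thesis using i \<open>finite I\<close> by (simp add: if_distrib if_distribR cong: if_cong)
    qed
    show "rho (g j) (g j') = (\<Sum>i\<in>I. (if g j = i then 1 else 0) * rho i (g j'))"
      if "j \<in> J" "j' \<in> J" for j j'
      using that \<open>finite I\<close> I by (simp add: if_distrib if_distribR cong: if_cong)
  qed (use \<open>finite I\<close> assms(1) in simp_all)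
qed

lemma vn_entropy_empty [simp]: "vn_entropy {} rho = 0"
proof -
  have "op_matrix {} rho = 0\<^sub>m 0 0" unfolding op_matrix_def Let_def card.empty by (rule eq_matI) simp_all
  then show ?thesis
    by (simp only: vn_entropy_root_entropy char_poly_zero_mat root_entropy_X_power)
qed

lemma vn_entropy_zero:
  assumes "finite I" "\<And>i i'. i \<in> I \<Longrightarrow> i' \<in> I \<Longrightarrow> rho i i' = 0"
  shows "vn_entropy I rho = 0"
  using vn_entropy_factor[OF assms(1) finite.emptyI, of rho "\<lambda>_ _. 0" "\<lambda>_ _. 0" "\<lambda>_ _. 0"] assms(2)
  by simp

lemma vn_entropy_singleton: "vn_entropy {i} rho = eta (Re (rho i i))"
proof -
  have "bij_betw (\<lambda>_. i) {..<1::nat} {i}" by (auto simp: bij_betw_def inj_on_def)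
  then have "vn_entropy {i} rho = root_entropy (char_poly (enum_mat (\<lambda>_. i) 1 rho))"
    by (intro vn_entropy_enum) auto
  also have "char_poly (enum_mat (\<lambda>_. i) 1 rho) = (\<Prod>a\<leftarrow>diag_mat (enum_mat (\<lambda>_. i) 1 rho). [:- a, 1:])"
    by (rule char_poly_upper_triangular[of _ 1]) (auto simp: upper_triangular_def enum_mat_def)
  also have "\<dots> = [:- rho i i, 1:]"
    by (simp add: diag_mat_def enum_mat_def)
  finally show ?thesis by (simp add: root_entropy_linear)
qed

lemma vn_entropy_transpose:
  assumes "finite I"
  shows "vn_entropy I (\<lambda>i j. rho j i) = vn_entropy I rho"
proof -
  obtain f where f: "\<And>rho. op_matrix I rho = enum_mat f (card I) rho"
    using op_matrix_enum[OF assms(1)] by metis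
  have "enum_mat f (card I) (\<lambda>i j. rho j i) = transpose_mat (enum_mat f (card I) rho)"
    by (intro eq_matI) (auto simp: enum_mat_def)
  then show ?thesis
    by (simp add: vn_entropy_root_entropy f char_poly_transpose_mat[OF enum_mat_carrier])
qed

text \<open>In an enumeration that lists \<open>I\<close> before \<open>J\<close> the matrix is
  block lower triangular, so characteristic polynomials multiply and entropies add.\<close>

lemma vn_entropy_Un:
  assumes fin: "finite I" "finite J" and disj: "I \<inter> J = {}"
    and zero: "\<And>i j. i \<in> I \<Longrightarrow> j \<in> J \<Longrightarrow> rho i j = 0"
  shows "vn_entropy (I \<union> J) rho = vn_entropy I rho + vn_entropy J rho"
proof -
  define m n where "m = card I" and "n = card J"
  obtain f where f: "bij_betw f {..<m} I"
    using op_matrix_enum[OF fin(1)] m_def by metis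
  obtain g where g: "bij_betw g {..<n} J"
    using op_matrix_enum[OF fin(2)] n_def by metis
  define h where "h k = (if k < m then f k else g (k - m))" for k
  have "bij_betw h {..<m} I" using f by (rule bij_betw_cong[THEN iffD1, rotated]) (simp add: h_def)
  moreover have "bij_betw h {m..<m + n} J"
  proof -
    have "bij_betw (\<lambda>k. k - m) {m..<m + n} {..<n}"
      by (rule bij_betwI[where g = "\<lambda>k. k + m"]) auto
    then have "bij_betw (\<lambda>k. g (k - m)) {m..<m + n} J"
      using bij_betw_trans[OF _ g] by (force simp: o_def)
    then show ?thesis by (rule bij_betw_cong[THEN iffD1, rotated]) (simp add: h_def)
  qed
  ultimately have "bij_betw h ({..<m} \<union> {m..<m + n}) (I \<union> J)"
    using disj by (rule bij_betw_combine)
  moreover have "{..<m} \<union> {m..<m + n} = {..<m + n}" by auto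
  ultimately have h: "bij_betw h {..<m + n} (I \<union> J)" by simp
  have fI: "f i \<in> I" if "i < m" for i using f that by (auto simp: bij_betw_def)
  have gJ: "g j \<in> J" if "j < n" for j using g that by (auto simp: bij_betw_def)
  have "enum_mat h (m + n) rho = four_block_mat (enum_mat f m rho) (0\<^sub>m m n)
     (mat n m (\<lambda>(j, i). rho (g j) (f i))) (enum_mat g n rho)"
    by (rule eq_matI) (auto simp: enum_mat_def h_def zero fI gJ)
  then have "char_poly (enum_mat h (m + n) rho) = char_poly (enum_mat f m rho) * char_poly (enum_mat g n rho)"
    by (simp add: char_poly_four_block_upper_right_zero)
  then have "root_entropy (char_poly (enum_mat h (m + n) rho)) =
      root_entropy (char_poly (enum_mat f m rho)) + root_entropy (char_poly (enum_mat g n rho))"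
    by (simp add: root_entropy_mult char_poly_nonzero[OF enum_mat_carrier])
  then show ?thesis
    using vn_entropy_enum[OF fin(1) f] vn_entropy_enum[OF fin(2) g] vn_entropy_enum[OF _ h] fin by simp
qed

text \<open>This is the shape of a classical-quantum state: \<open>c\<close> is a measured register
  and \<open>R c\<close> the unnormalized operator conditional on it. Blocks are split off one at a
  time.\<close>

lemma vn_entropy_blocks:
  assumes "finite C" "finite Q"
    and "\<And>c c' q q'. c \<in> C \<Longrightarrow> c' \<in> C \<Longrightarrow> q \<in> Q \<Longrightarrow> q' \<in> Q \<Longrightarrow>
           rho (c, q) (c', q') = (if c = c' then R c q q' else 0)"
  shows "vn_entropy (C \<times> Q) rho = (\<Sum>c\<in>C. vn_entropy Q (R c))"
  using assms
proof (induction C rule: finite_induct)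
  case empty
  then show ?case by simp
next
  case (insert c C)
  have "insert c C \<times> Q = {c} \<times> Q \<union> C \<times> Q" by auto
  then have "vn_entropy (insert c C \<times> Q) rho = vn_entropy ({c} \<times> Q \<union> C \<times> Q) rho" by simp
  also have "\<dots> = vn_entropy ({c} \<times> Q) rho + vn_entropy (C \<times> Q) rho"
    using insert by (intro vn_entropy_Un) auto
  also have "vn_entropy (C \<times> Q) rho = (\<Sum>c\<in>C. vn_entropy Q (R c))"
    using insert.prems by (intro insert.IH) auto
  also have "vn_entropy ({c} \<times> Q) rho = vn_entropy Q (\<lambda>q q'. rho (c, q) (c, q'))"
    using vn_entropy_reindex[OF insert.prems(1), of "Pair c" "{c} \<times> Q" rho]
    by (auto simp: bij_betw_def inj_on_def)
  also have "\<dots> = vn_entropy Q (R c)"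
    using insert by (intro vn_entropy_cong) auto
  finally show ?case using insert by simp
qed

lemma vn_entropy_diagonal:
  assumes "finite C"
    and "\<And>c c'. c \<in> C \<Longrightarrow> c' \<in> C \<Longrightarrow> rho c c' = (if c = c' then d c else 0)"
  shows "vn_entropy C rho = (\<Sum>c\<in>C. eta (Re (d c)))"
proof -
  have "vn_entropy C rho = vn_entropy (C \<times> {()}) (\<lambda>j j'. rho (fst j) (fst j'))"
    using assms(1) by (intro vn_entropy_reindex) (auto simp: bij_betw_def inj_on_def)
  also have "\<dots> = (\<Sum>c\<in>C. vn_entropy {()} (\<lambda>_ _. d c))"
    using assms by (intro vn_entropy_blocks) auto
  finally show ?thesis by (simp add: vn_entropy_singleton)
qed

text \<open>The two marginals of the bipartite vector \<open>g\<close> are \<open>A B\<close> and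
  the transpose of \<open>B A\<close>, with \<open>B\<close> the adjoint of \<open>A\<close>;
  transposition keeps the characteristic polynomial.\<close>

lemma vn_entropy_Schmidt:
  assumes "finite I" "finite J"
  shows "vn_entropy I (\<lambda>i i'. \<Sum>j\<in>J. g i j * cnj (g i' j)) =
         vn_entropy J (\<lambda>j j'. \<Sum>i\<in>I. g i j * cnj (g i j'))"
proof -
  have "vn_entropy I (\<lambda>i i'. \<Sum>j\<in>J. g i j * cnj (g i' j)) =
        vn_entropy J (\<lambda>j j'. \<Sum>i\<in>I. g i j' * cnj (g i j))"
    by (rule vn_entropy_factor[where A = g and B = "\<lambda>j i. cnj (g i j)"])
       (use assms in \<open>auto simp: mult.commute\<close>)
  then show ?thesis
    by (simp add: vn_entropy_transpose[OF assms(2), of "\<lambda>j j'. \<Sum>i\<in>I. g i j * cnj (g i j')"])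
qed

subsection \<open>Spectral theorem\<close>

definition hermitian_on :: "'i set \<Rightarrow> ('i \<Rightarrow> 'i \<Rightarrow> complex) \<Rightarrow> bool" where
  "hermitian_on I rho \<longleftrightarrow> (\<forall>i\<in>I. \<forall>j\<in>I. rho j i = cnj (rho i j))"

lemma hermitian_onD: "hermitian_on I rho \<Longrightarrow> i \<in> I \<Longrightarrow> j \<in> I \<Longrightarrow> cnj (rho i j) = rho j i"
  by (metis hermitian_on_def)

text \<open>The vectors \<open>v j\<close> are indexed by \<open>I\<close> itself, so
  \<open>v\<close> is a unitary matrix. Orthonormality and completeness are both recorded, so that
  neither has to be derived from the other.\<close>

definition orthonormal_basis :: "'i set \<Rightarrow> ('i \<Rightarrow> 'i \<Rightarrow> complex) \<Rightarrow> bool" where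
  "orthonormal_basis I v \<longleftrightarrow>
     (\<forall>j\<in>I. \<forall>k\<in>I. (\<Sum>i\<in>I. cnj (v j i) * v k i) = (if j = k then 1 else 0)) \<and>
     (\<forall>i\<in>I. \<forall>k\<in>I. (\<Sum>j\<in>I. v j i * cnj (v j k)) = (if i = k then 1 else 0))"

definition eigenbasis ::
    "'i set \<Rightarrow> ('i \<Rightarrow> 'i \<Rightarrow> complex) \<Rightarrow> ('i \<Rightarrow> real) \<Rightarrow> ('i \<Rightarrow> 'i \<Rightarrow> complex) \<Rightarrow> bool" where
  "eigenbasis I rho l v \<longleftrightarrow> orthonormal_basis I v \<and>
     (\<forall>j\<in>I. \<forall>i\<in>I. (\<Sum>k\<in>I. rho i k * v j k) = of_real (l j) * v j i)"

text \<open>The fundamental theorem of algebra gives a root of the characteristic polynomial; an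
  eigenvector for it is then normalized.\<close>

lemma exists_eigenvector:
  fixes rho :: "nat \<Rightarrow> nat \<Rightarrow> complex"
  assumes "n > 0"
  obtains u e where "(\<Sum>i<n. (cmod (u i))\<^sup>2) = 1" "\<And>i. i < n \<Longrightarrow> (\<Sum>k<n. rho i k * u k) = e * u i"
proof -
  let ?A = "mat n n (\<lambda>(i, j). rho i j)"
  have A: "?A \<in> carrier_mat n n" by simp
  have "degree (char_poly ?A) \<noteq> 0" using degree_monic_char_poly[OF A] assms by simp
  then have "\<not> constant (poly (char_poly ?A))" by (simp add: constant_degree)
  then obtain e where "poly (char_poly ?A) e = 0"
    using fundamental_theorem_of_algebra by blast
  then obtain w where "eigenvector ?A w e"
    using eigenvalue_root_char_poly[OF A] by (auto simp: eigenvalue_def)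
  then have w: "w \<in> carrier_vec n" "w \<noteq> 0\<^sub>v n" "?A *\<^sub>v w = e \<cdot>\<^sub>v w"
    by (auto simp: eigenvector_def)
  have eq: "(\<Sum>k<n. rho i k * w $ k) = e * w $ i" if "i < n" for i
  proof -
    have "(\<Sum>k<n. rho i k * w $ k) = (?A *\<^sub>v w) $ i"
      using that w(1) by (auto simp: scalar_prod_def atLeast0LessThan)
    also have "\<dots> = e * w $ i" using that w by simp
    finally show ?thesis .
  qed
  define s where "s = (\<Sum>i<n. (cmod (w $ i))\<^sup>2)"
  obtain i0 where i0: "i0 < n" "w $ i0 \<noteq> 0"
    using w(1,2) by (metis carrier_vecD eq_vecI index_zero_vec(1,2))
  have "(cmod (w $ i0))\<^sup>2 \<le> s" unfolding s_def by (rule member_le_sum) (use i0 in auto)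
  moreover have "0 < (cmod (w $ i0))\<^sup>2" using i0 by simp
  ultimately have s: "s > 0" by linarith
  define u where "u i = w $ i / of_real (sqrt s)" for i
  have "(\<Sum>i<n. (cmod (u i))\<^sup>2) = 1"
  proof -
    have "(\<Sum>i<n. (cmod (u i))\<^sup>2) = (\<Sum>i<n. (cmod (w $ i))\<^sup>2 / s)"
      unfolding u_def using s by (intro sum.cong) (auto simp: norm_divide power_divide)
    then show ?thesis using s by (simp add: sum_divide_distrib[symmetric] s_def)
  qed
  moreover have "(\<Sum>k<n. rho i k * u k) = e * u i" if "i < n" for i
    using eq[OF that] by (simp add: u_def sum_divide_distrib[symmetric])
  ultimately show ?thesis using that by blast
qed

lemma sum_delta_mult:
  fixes f :: "'i \<Rightarrow> 'a :: semiring_1"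
  assumes "finite S" "a \<in> S"
  shows "(\<Sum>k\<in>S. (if a = k then 1 else 0) * f k) = f a" "(\<Sum>k\<in>S. (if k = a then 1 else 0) * f k) = f a"
    "(\<Sum>k\<in>S. f k * (if a = k then 1 else 0)) = f a" "(\<Sum>k\<in>S. f k * (if k = a then 1 else 0)) = f a"
  using assms by (simp_all add: if_distrib if_distribR cong: if_cong)

text \<open>The Householder reflection exchanging the unit vector at index \<open>n\<close> with \<open>u\<close>; a nonpositive
  last entry of \<open>u\<close> keeps the denominator \<open>1 - c\<close> away from zero.\<close>
lemma householder:
  fixes u :: "nat \<Rightarrow> complex"
  assumes u: "(\<Sum>i<Suc n. (cmod (u i))\<^sup>2) = 1" and c: "u n = of_real c" "c \<le> 0"
  obtains h where "orthonormal_basis {..<Suc n} h" "\<And>i. i < Suc n \<Longrightarrow> h n i = u i"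
proof -
  define w where "w i = u i - (if i = n then 1 else 0)" for i
  define h where "h j i = (if i = j then 1 else 0) - w i * cnj (w j) / of_real (1 - c)" for j i
  have d: "(1 - of_real c :: complex) \<noteq> 0"
    using c(2) by (metis add_diff_cancel_left' diff_add_cancel not_one_le_zero of_real_1 of_real_eq_iff right_minus_eq)
  \<comment> \<open>As \<open>w\<close> is \<open>u\<close> minus the last unit vector, its squared
    norm is \<open>2 - 2 * c\<close>. This value makes the reflection an involution.\<close>
  have w2: "(\<Sum>i<Suc n. w i * cnj (w i)) = 2 * (1 - of_real c)"
  proof -
    have *: "(\<Sum>i<n. w i * cnj (w i)) = (\<Sum>i<n. of_real ((cmod (u i))\<^sup>2))"
      by (intro sum.cong) (auto simp: w_def complex_norm_square simp del: of_real_power)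
    have "(\<Sum>i<n. (cmod (u i))\<^sup>2) = 1 - c\<^sup>2" using u c by simp
    then have "(\<Sum>i<n. w i * cnj (w i)) = of_real (1 - c\<^sup>2)" unfolding * of_real_sum[symmetric] by simp
    then show ?thesis using c by (simp add: w_def algebra_simps power2_eq_square)
  qed
  have herm: "cnj (h j i) = h i j" for i j
    by (simp add: h_def mult.commute)
  have sq: "(\<Sum>i<Suc n. h j i * h i k) = (if j = k then 1 else 0)" if "j < Suc n" "k < Suc n" for j k
  proof -
    let ?d = "1 - of_real c :: complex"
    have "(\<Sum>i<Suc n. h j i * h i k) =
       (\<Sum>i<Suc n. (if i = j then 1 else 0) * (if k = i then 1 else 0)
          - (if i = j then 1 else 0) * (w k * cnj (w i) / ?d)
          - (if k = i then 1 else 0) * (w i * cnj (w j) / ?d)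
          + (w i * cnj (w i)) * (w k * cnj (w j) / ?d\<^sup>2))"
      by (intro sum.cong refl) (simp add: h_def algebra_simps power2_eq_square)
    also have "\<dots> = (if k = j then 1 else 0) - w k * cnj (w j) / ?d - w k * cnj (w j) / ?d
        + (\<Sum>i<Suc n. w i * cnj (w i)) * (w k * cnj (w j) / ?d\<^sup>2)"
      using that by (simp only: sum.distrib sum_subtractf sum_delta_mult finite_lessThan lessThan_iff sum_distrib_right[symmetric])
    also have "\<dots> = (if k = j then 1 else 0)"
    proof -
      have "a - X / D - X / D + 2 * D * (X / D\<^sup>2) = a" if "D \<noteq> 0" for a X D :: complex
        using that by (simp add: field_simps power2_eq_square)
      then show ?thesis unfolding w2 using d by blast
    qed
    finally show ?thesis by auto
  qed
  have "orthonormal_basis {..<Suc n} h"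
    unfolding orthonormal_basis_def
  proof (intro conjI ballI)
    fix j k assume jk: "j \<in> {..<Suc n}" "k \<in> {..<Suc n}"
    show "(\<Sum>i<Suc n. cnj (h j i) * h k i) = (if j = k then 1 else 0)"
      using sq[of k j] jk by (simp add: herm mult.commute eq_commute[of k j] del: sum.lessThan_Suc)
    show "(\<Sum>i<Suc n. h i j * cnj (h i k)) = (if j = k then 1 else 0)"
      using sq[of k j] jk by (simp add: herm mult.commute eq_commute[of k j] del: sum.lessThan_Suc)
  qed
  moreover have "h n i = u i" if "i < Suc n" for i
  proof -
    have "cnj (w n) / of_real (1 - c) = -1" using c d by (simp add: w_def divide_eq_eq)
    then have "w i * cnj (w n) / of_real (1 - c) = - w i" by (metis mult_minus1_right times_divide_eq_right)
    then show ?thesis by (simp add: h_def w_def)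
  qed
  ultimately show ?thesis using that by blast
qed

text \<open>The eigenvalue is the quadratic form of \<open>rho\<close> at the unit vector
  \<open>u\<close>, and Hermitian symmetry makes that form equal to its conjugate.\<close>

lemma hermitian_eigenvalue_real:
  assumes H: "hermitian_on I rho" and fin: "finite I" and u: "(\<Sum>i\<in>I. (cmod (u i))\<^sup>2) = 1"
    and e: "\<And>i. i \<in> I \<Longrightarrow> (\<Sum>k\<in>I. rho i k * u k) = e * u i"
  shows "e = of_real (Re e)"
proof -
  have uu: "(\<Sum>i\<in>I. cnj (u i) * u i) = 1"
    using arg_cong[OF u, of complex_of_real] by (simp add: complex_norm_square mult.commute del: of_real_power)
  have "e = (\<Sum>i\<in>I. cnj (u i) * (e * u i))"
    using uu by (simp add: mult.left_commute sum_distrib_left[symmetric])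
  also have "\<dots> = (\<Sum>i\<in>I. \<Sum>k\<in>I. cnj (u i) * rho i k * u k)"
    by (intro sum.cong refl) (simp add: e[symmetric] sum_distrib_left mult.assoc)
  finally have e1: "e = (\<Sum>i\<in>I. \<Sum>k\<in>I. cnj (u i) * rho i k * u k)" .
  have "cnj e = (\<Sum>i\<in>I. \<Sum>k\<in>I. u i * cnj (rho i k) * cnj (u k))"
    by (subst e1) simp
  also have "\<dots> = (\<Sum>i\<in>I. \<Sum>k\<in>I. cnj (u k) * rho k i * u i)"
    by (intro sum.cong refl) (simp add: hermitian_onD[OF H] mult_ac)
  also have "\<dots> = e" by (subst sum.swap) (simp add: e1[symmetric])
  finally show ?thesis by (metis complex_cnj_cancel_iff Reals_cnj_iff of_real_Re)
qed

text \<open>Induction by deflation: a unit eigenvector is completed to an orthonormal basis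
  \<open>h\<close>, in which the operator splits into the eigenvalue \<open>e\<close> and a
  Hermitian block of size \<open>n\<close> for the induction hypothesis.\<close>

lemma spectral_theorem_nat:
  fixes rho :: "nat \<Rightarrow> nat \<Rightarrow> complex"
  assumes "hermitian_on {..<n} rho"
  shows "\<exists>l v. eigenbasis {..<n} rho l v"
  using assms
proof (induction n arbitrary: rho)
  case 0
  then show ?case by (simp add: eigenbasis_def orthonormal_basis_def)
next
  case (Suc n)
  let ?I = "{..<Suc n}"
  obtain u0 e where u0: "(\<Sum>i<Suc n. (cmod (u0 i))\<^sup>2) = 1"
    and e0: "\<And>i. i < Suc n \<Longrightarrow> (\<Sum>k<Suc n. rho i k * u0 k) = e * u0 i"
    using exists_eigenvector[of "Suc n" rho] by blast
  \<comment> \<open>The phase \<open>t\<close> turns the last entry of the eigenvector into minus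
    its modulus, as the reflection requires.\<close>
  define t where "t = (if u0 n = 0 then 1 else - cnj (u0 n) / of_real (cmod (u0 n)))"
  define u where "u i = t * u0 i" for i
  have t1: "cmod t = 1" by (simp add: t_def norm_divide)
  have u: "(\<Sum>i<Suc n. (cmod (u i))\<^sup>2) = 1" using u0 by (simp add: u_def norm_mult t1)
  have e: "(\<Sum>k<Suc n. rho i k * u k) = e * u i" if "i < Suc n" for i
  proof -
    have "(\<Sum>k<Suc n. rho i k * u k) = t * (\<Sum>k<Suc n. rho i k * u0 k)"
      unfolding u_def sum_distrib_left by (intro sum.cong) auto
    then show ?thesis unfolding e0[OF that] by (simp add: u_def)
  qed
  have un: "u n = of_real (- cmod (u0 n))"
  proof (cases "u0 n = 0")
    case False
    have "cnj (u0 n) * u0 n = of_real (cmod (u0 n)) * of_real (cmod (u0 n))"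
      by (metis complex_norm_square mult.commute of_real_mult power2_eq_square)
    then show ?thesis using False by (simp add: u_def t_def)
  qed (simp add: u_def)
  have er: "e = of_real (Re e)"
    using hermitian_eigenvalue_real[OF Suc.prems finite_lessThan u] e by blast
  obtain h where ob: "orthonormal_basis ?I h" and hn: "\<And>i. i < Suc n \<Longrightarrow> h n i = u i"
    using householder[OF u un] by auto
  have ho: "(\<Sum>i\<in>?I. cnj (h j i) * h k i) = (if j = k then 1 else 0)" if "j \<in> ?I" "k \<in> ?I" for j k
    using ob that unfolding orthonormal_basis_def by blast
  have hc: "(\<Sum>j\<in>?I. h j i * cnj (h j k)) = (if i = k then 1 else 0)" if "i \<in> ?I" "k \<in> ?I" for i k
    using ob that unfolding orthonormal_basis_def by blast
  have eh: "(\<Sum>k\<in>?I. rho i k * h n k) = e * h n i" if "i \<in> ?I" for i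
    using e[of i] that hn by (simp del: sum.lessThan_Suc)
  \<comment> \<open>\<open>B\<close> is the matrix of \<open>rho\<close> in the basis
    \<open>h\<close>; its last column is \<open>e\<close> times the last unit vector because
    \<open>h n\<close> is the eigenvector.\<close>
  define B where "B m k = (\<Sum>i\<in>?I. \<Sum>i'\<in>?I. cnj (h m i) * rho i i' * h k i')" for m k
  have Bh: "B k m = cnj (B m k)" for m k
  proof -
    have "cnj (B m k) = (\<Sum>i\<in>?I. \<Sum>i'\<in>?I. cnj (h k i') * rho i' i * h m i)"
      unfolding B_def cnj_sum
      by (intro sum.cong refl) (simp add: hermitian_onD[OF Suc.prems] mult_ac del: lessThan_iff)
    also have "\<dots> = B k m" unfolding B_def by (rule sum.swap)
    finally show ?thesis by simp
  qed
  have Bn: "B m n = (if m = n then e else 0)" if "m \<in> ?I" for m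
  proof -
    have "B m n = (\<Sum>i\<in>?I. cnj (h m i) * (\<Sum>i'\<in>?I. rho i i' * h n i'))"
      unfolding B_def sum_distrib_left by (simp only: mult.assoc)
    also have "\<dots> = (\<Sum>i\<in>?I. cnj (h m i) * (e * h n i))"
      by (intro sum.cong refl) (simp only: eh)
    also have "\<dots> = e * (\<Sum>i\<in>?I. cnj (h m i) * h n i)"
      by (simp only: sum_distrib_left mult.left_commute)
    also have "\<dots> = (if m = n then e else 0)" using ho[OF that, of n] by simp
    finally show ?thesis .
  qed
  \<comment> \<open>Completeness of \<open>h\<close> turns the definition of \<open>B\<close> into
    the intertwining relation between \<open>rho\<close> and \<open>B\<close>.\<close>
  have rhoh: "(\<Sum>k\<in>?I. rho i k * h j k) = (\<Sum>m\<in>?I. h m i * B m j)" if "i \<in> ?I" for i j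
  proof -
    have "(\<Sum>m\<in>?I. h m i * B m j) = (\<Sum>m\<in>?I. \<Sum>p\<in>?I. \<Sum>q\<in>?I. (h m i * cnj (h m p)) * (rho p q * h j q))"
      unfolding B_def sum_distrib_left by (simp only: mult_ac)
    also have "\<dots> = (\<Sum>p\<in>?I. \<Sum>m\<in>?I. \<Sum>q\<in>?I. (h m i * cnj (h m p)) * (rho p q * h j q))"
      by (rule sum.swap)
    also have "\<dots> = (\<Sum>p\<in>?I. (\<Sum>m\<in>?I. h m i * cnj (h m p)) * (\<Sum>q\<in>?I. rho p q * h j q))"
      by (simp only: sum_product)
    also have "\<dots> = (\<Sum>p\<in>?I. (if i = p then 1 else 0) * (\<Sum>q\<in>?I. rho p q * h j q))"
      by (intro sum.cong refl) (simp only: hc[OF that])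
    also have "\<dots> = (\<Sum>q\<in>?I. rho i q * h j q)"
      using that by (simp only: sum_delta_mult finite_lessThan)
    finally show ?thesis by simp
  qed
  have "hermitian_on {..<n} B" unfolding hermitian_on_def using Bh by blast
  then obtain l' v' where ev: "eigenbasis {..<n} B l' v'" using Suc.IH by blast
  have vo: "(\<Sum>i<n. cnj (v' j i) * v' k i) = (if j = k then 1 else 0)" if "j < n" "k < n" for j k
    using ev that by (auto simp: eigenbasis_def orthonormal_basis_def)
  have vc: "(\<Sum>j<n. v' j i * cnj (v' j k)) = (if i = k then 1 else 0)" if "i < n" "k < n" for i k
    using ev that by (auto simp: eigenbasis_def orthonormal_basis_def)
  have ve: "(\<Sum>k<n. B i k * v' j k) = of_real (l' j) * v' j i" if "i < n" "j < n" for i j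
    using ev that by (auto simp: eigenbasis_def)
  \<comment> \<open>The eigenbasis of the block is padded by the last unit vector, with eigenvalue
    \<open>Re e\<close>.\<close>
  define V where "V j k = (if j < n \<and> k < n then v' j k else if j = k then 1 else 0)" for j k
  define l where "l j = (if j < n then l' j else Re e)" for j
  have Vo: "(\<Sum>i\<in>?I. cnj (V j i) * V k i) = (if j = k then 1 else 0)" if "j \<in> ?I" "k \<in> ?I" for j k
  proof -
    have *: "(\<Sum>i<n. cnj (V j i) * V k i) = (if j < n \<and> k < n then \<Sum>i<n. cnj (v' j i) * v' k i else 0)"
      using that by (auto simp: V_def intro!: sum.neutral sum.cong)
    show ?thesis unfolding sum.lessThan_Suc * using that vo by (auto simp: V_def)
  qed
  have Vc: "(\<Sum>j\<in>?I. V j i * cnj (V j k)) = (if i = k then 1 else 0)" if "i \<in> ?I" "k \<in> ?I" for i k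
  proof -
    have *: "(\<Sum>j<n. V j i * cnj (V j k)) = (if i < n \<and> k < n then \<Sum>j<n. v' j i * cnj (v' j k) else 0)"
      using that by (auto simp: V_def intro!: sum.neutral sum.cong)
    show ?thesis unfolding sum.lessThan_Suc * using that vc by (auto simp: V_def)
  qed
  have Ve: "(\<Sum>k\<in>?I. B i k * V j k) = of_real (l j) * V j i" if "i \<in> ?I" "j \<in> ?I" for i j
  proof -
    \<comment> \<open>By symmetry the last row of \<open>B\<close> also vanishes off the diagonal,
      so \<open>B\<close> maps vectors of the block into the block.\<close>
    have Bn': "B n k = (if k = n then e else 0)" if "k \<in> ?I" for k
      using Bn[OF that] Bh[of n k] Bn[of n] by (metis complex_cnj_zero lessThan_iff lessI)
    show ?thesis
    proof (cases "j < n")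
      case True
      then have "(\<Sum>k\<in>?I. B i k * V j k) = (\<Sum>k<n. B i k * v' j k)" by (simp add: V_def)
      moreover have "(\<Sum>k<n. B n k * v' j k) = 0" using Bn' by (intro sum.neutral) auto
      ultimately show ?thesis using True that ve[of i j] by (auto simp: V_def l_def less_Suc_eq)
    next
      case False
      then have "(\<Sum>k<n. B i k * V j k) = 0" using that by (intro sum.neutral) (auto simp: V_def)
      then show ?thesis using False that Bn[of i] er by (auto simp: V_def l_def)
    qed
  qed
  \<comment> \<open>Back to the original coordinates; \<open>v\<close> is unitary as a product of
    the unitary matrices \<open>V\<close> and \<open>h\<close>.\<close>
  define v where "v j i = (\<Sum>k\<in>?I. V j k * h k i)" for j i
  have "(\<Sum>i\<in>?I. cnj (v j i) * v k i) = (if j = k then 1 else 0)" if "j \<in> ?I" "k \<in> ?I" for j k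
  proof -
    have "(\<Sum>i\<in>?I. cnj (v j i) * v k i) =
        (\<Sum>i\<in>?I. \<Sum>p\<in>?I. \<Sum>q\<in>?I. (cnj (V j p) * V k q) * (cnj (h p i) * h q i))"
      unfolding v_def cnj_sum sum_product complex_cnj_mult by (simp only: mult_ac)
    also have "\<dots> = (\<Sum>p\<in>?I. \<Sum>i\<in>?I. \<Sum>q\<in>?I. (cnj (V j p) * V k q) * (cnj (h p i) * h q i))"
      by (rule sum.swap)
    also have "\<dots> = (\<Sum>p\<in>?I. \<Sum>q\<in>?I. \<Sum>i\<in>?I. (cnj (V j p) * V k q) * (cnj (h p i) * h q i))"
      by (intro sum.cong refl sum.swap)
    also have "\<dots> = (\<Sum>p\<in>?I. \<Sum>q\<in>?I. (cnj (V j p) * V k q) * (if p = q then 1 else 0))"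
      by (intro sum.cong refl) (simp only: sum_distrib_left[symmetric] ho)
    also have "\<dots> = (\<Sum>p\<in>?I. cnj (V j p) * V k p)"
      by (intro sum.cong refl) (simp only: sum_delta_mult finite_lessThan)
    finally show ?thesis using Vo[OF that] by simp
  qed
  moreover have "(\<Sum>j\<in>?I. v j i * cnj (v j k)) = (if i = k then 1 else 0)" if "i \<in> ?I" "k \<in> ?I" for i k
  proof -
    have "(\<Sum>j\<in>?I. v j i * cnj (v j k)) =
        (\<Sum>j\<in>?I. \<Sum>p\<in>?I. \<Sum>q\<in>?I. (h p i * cnj (h q k)) * (V j p * cnj (V j q)))"
      unfolding v_def cnj_sum sum_product complex_cnj_mult by (simp only: mult_ac)
    also have "\<dots> = (\<Sum>p\<in>?I. \<Sum>j\<in>?I. \<Sum>q\<in>?I. (h p i * cnj (h q k)) * (V j p * cnj (V j q)))"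
      by (rule sum.swap)
    also have "\<dots> = (\<Sum>p\<in>?I. \<Sum>q\<in>?I. \<Sum>j\<in>?I. (h p i * cnj (h q k)) * (V j p * cnj (V j q)))"
      by (intro sum.cong refl sum.swap)
    also have "\<dots> = (\<Sum>p\<in>?I. \<Sum>q\<in>?I. (h p i * cnj (h q k)) * (if p = q then 1 else 0))"
      by (intro sum.cong refl) (simp only: sum_distrib_left[symmetric] Vc)
    also have "\<dots> = (\<Sum>p\<in>?I. h p i * cnj (h p k))"
      by (intro sum.cong refl) (simp only: sum_delta_mult finite_lessThan)
    finally show ?thesis using hc[OF that] by simp
  qed
  moreover have "(\<Sum>k\<in>?I. rho i k * v j k) = of_real (l j) * v j i" if "j \<in> ?I" "i \<in> ?I" for i j
  proof -
    have "(\<Sum>k\<in>?I. rho i k * v j k) = (\<Sum>k\<in>?I. \<Sum>p\<in>?I. V j p * (rho i k * h p k))"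
      unfolding v_def sum_distrib_left by (simp only: mult_ac)
    also have "\<dots> = (\<Sum>p\<in>?I. \<Sum>k\<in>?I. V j p * (rho i k * h p k))" by (rule sum.swap)
    also have "\<dots> = (\<Sum>p\<in>?I. V j p * (\<Sum>m\<in>?I. h m i * B m p))"
      by (simp only: sum_distrib_left[symmetric] rhoh[OF that(2)])
    also have "\<dots> = (\<Sum>p\<in>?I. \<Sum>m\<in>?I. h m i * (B m p * V j p))"
      unfolding sum_distrib_left by (simp only: mult_ac)
    also have "\<dots> = (\<Sum>m\<in>?I. \<Sum>p\<in>?I. h m i * (B m p * V j p))" by (rule sum.swap)
    also have "\<dots> = (\<Sum>m\<in>?I. h m i * (of_real (l j) * V j m))"
      by (intro sum.cong refl) (simp only: sum_distrib_left[symmetric] Ve that)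
    also have "\<dots> = of_real (l j) * v j i"
      unfolding v_def sum_distrib_left by (simp only: mult_ac)
    finally show ?thesis .
  qed
  ultimately have "eigenbasis ?I rho l v"
    unfolding eigenbasis_def orthonormal_basis_def by blast
  then show ?case by blast
qed

lemma spectral_theorem:
  assumes fin: "finite I" and H: "hermitian_on I rho"
  obtains l v where "eigenbasis I rho l v"
proof -
  obtain f where f: "bij_betw f {..<card I} I" using op_matrix_enum[OF fin] by metis
  define g where "g = the_inv_into {..<card I} f"
  have inj: "inj_on f {..<card I}" and I: "I = f ` {..<card I}" using f by (auto simp: bij_betw_def)
  have gf: "g (f i) = i" if "i < card I" for i
    unfolding g_def using the_inv_into_f_f[OF inj] that by simp
  have fI: "f i \<in> I" if "i < card I" for i using that I by blast
  have "hermitian_on {..<card I} (\<lambda>i j. rho (f i) (f j))"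
    unfolding hermitian_on_def by (simp add: fI hermitian_onD[OF H] del: complex_cnj_cancel_iff)
  then obtain l v where ev: "eigenbasis {..<card I} (\<lambda>i j. rho (f i) (f j)) l v"
    using spectral_theorem_nat by blast
  note ev' = ev[unfolded eigenbasis_def orthonormal_basis_def]
  have "eigenbasis I rho (\<lambda>i. l (g i)) (\<lambda>j i. v (g j) (g i))"
    unfolding eigenbasis_def orthonormal_basis_def sum.reindex_bij_betw[OF f, symmetric]
  proof (intro conjI ballI)
    fix j k assume "j \<in> I" "k \<in> I"
    then obtain j' k' where j: "j' < card I" "j = f j'" and k: "k' < card I" "k = f k'"
      using bij_betw_imp_surj_on[OF f] by blast
    have jk: "j = k \<longleftrightarrow> j' = k'" using j k gf by metis
    show "(\<Sum>i<card I. cnj (v (g j) (g (f i))) * v (g k) (g (f i))) = (if j = k then 1 else 0)"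
      using ev'[THEN conjunct1, THEN conjunct1] j k unfolding jk by (simp add: gf)
    show "(\<Sum>i<card I. v (g (f i)) (g j) * cnj (v (g (f i)) (g k))) = (if j = k then 1 else 0)"
      using ev'[THEN conjunct1, THEN conjunct2] j k unfolding jk by (simp add: gf)
    show "(\<Sum>i<card I. rho k (f i) * v (g j) (g (f i))) = complex_of_real (l (g j)) * v (g j) (g k)"
      using ev'[THEN conjunct2] j k by (simp add: gf)
  qed
  then show ?thesis using that by blast
qed

section \<open>Entropy, quadratic form, norms and trace in an eigenbasis\<close>

lemma eigenbasis_decomposition:
  assumes fin: "finite I" and ev: "eigenbasis I rho l v" and i: "i \<in> I" "i' \<in> I"
  shows "rho i i' = (\<Sum>j\<in>I. of_real (l j) * v j i * cnj (v j i'))"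
proof -
  have "(\<Sum>j\<in>I. of_real (l j) * v j i * cnj (v j i')) = (\<Sum>j\<in>I. (\<Sum>k\<in>I. rho i k * v j k) * cnj (v j i'))"
    using ev i by (intro sum.cong refl) (simp add: eigenbasis_def)
  also have "\<dots> = (\<Sum>j\<in>I. \<Sum>k\<in>I. rho i k * (v j k * cnj (v j i')))"
    unfolding sum_distrib_right by (simp only: mult.assoc)
  also have "\<dots> = (\<Sum>k\<in>I. \<Sum>j\<in>I. rho i k * (v j k * cnj (v j i')))" by (rule sum.swap)
  also have "\<dots> = (\<Sum>k\<in>I. rho i k * (if k = i' then 1 else 0))"
    using ev i by (intro sum.cong refl) (simp add: sum_distrib_left[symmetric] eigenbasis_def orthonormal_basis_def)
  also have "\<dots> = rho i i'" using fin i by (simp only: sum_delta_mult)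
  finally show ?thesis by simp
qed

text \<open>The spectral decomposition is a product of two factors; in the opposite order they give,
  by orthonormality, the diagonal matrix of the eigenvalues.\<close>

lemma vn_entropy_eigenbasis:
  assumes fin: "finite I" and ev: "eigenbasis I rho l v"
  shows "vn_entropy I rho = (\<Sum>j\<in>I. eta (l j))"
proof -
  have "vn_entropy I rho = vn_entropy I (\<lambda>j j'. if j = j' then of_real (l j) else 0)"
  proof (rule vn_entropy_factor[where A = "\<lambda>i j. of_real (l j) * v j i" and B = "\<lambda>j i. cnj (v j i)"])
    show "rho i i' = (\<Sum>j\<in>I. of_real (l j) * v j i * cnj (v j i'))" if "i \<in> I" "i' \<in> I" for i i'
      using that by (rule eigenbasis_decomposition[OF fin ev])
    show "(if j = j' then complex_of_real (l j) else 0) = (\<Sum>i\<in>I. cnj (v j i) * (of_real (l j') * v j' i))"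
      if "j \<in> I" "j' \<in> I" for j j'
    proof -
      have "(\<Sum>i\<in>I. cnj (v j i) * (of_real (l j') * v j' i)) = of_real (l j') * (\<Sum>i\<in>I. cnj (v j i) * v j' i)"
        by (simp only: sum_distrib_left mult.left_commute)
      then show ?thesis using ev that by (simp add: eigenbasis_def orthonormal_basis_def)
    qed
  qed fact+
  also have "\<dots> = (\<Sum>j\<in>I. eta (l j))"
    using vn_entropy_diagonal[OF fin, of _ "\<lambda>j. of_real (l j)"] by simp
  finally show ?thesis .
qed

lemma orthonormal_basis_norm:
  assumes "orthonormal_basis I v" "j \<in> I"
  shows "(\<Sum>x\<in>I. (cmod (v j x))\<^sup>2) = 1"
proof -
  have "complex_of_real (\<Sum>x\<in>I. (cmod (v j x))\<^sup>2) = (\<Sum>x\<in>I. cnj (v j x) * v j x)"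
    by (simp add: complex_norm_square mult.commute del: of_real_power)
  also have "\<dots> = 1" using assms by (simp add: orthonormal_basis_def)
  finally show ?thesis using of_real_eq_1_iff by blast
qed

lemma orthonormal_basis_expand:
  assumes fin: "finite I" and v: "orthonormal_basis I v" and x: "x \<in> I"
  shows "f x = (\<Sum>i\<in>I. v i x * (\<Sum>y\<in>I. cnj (v i y) * f y))"
proof -
  have "(\<Sum>i\<in>I. v i x * (\<Sum>y\<in>I. cnj (v i y) * f y)) = (\<Sum>i\<in>I. \<Sum>y\<in>I. (v i x * cnj (v i y)) * f y)"
    unfolding sum_distrib_left by (simp only: mult.assoc)
  also have "\<dots> = (\<Sum>y\<in>I. \<Sum>i\<in>I. (v i x * cnj (v i y)) * f y)" by (rule sum.swap)
  also have "\<dots> = (\<Sum>y\<in>I. (if x = y then 1 else 0) * f y)"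
    using v x by (intro sum.cong refl) (simp add: sum_distrib_right[symmetric] orthonormal_basis_def)
  also have "\<dots> = f x" using fin x by (simp only: sum_delta_mult)
  finally show ?thesis by simp
qed

text \<open>Inserting the spectral decomposition diagonalizes the form. This serves the sign of
  eigenvalues, Parseval's identity and the overlaps of different eigenbases.\<close>

lemma eigenbasis_quadratic_form:
  assumes fin: "finite I" and ev: "eigenbasis I rho l v"
  shows "(\<Sum>x\<in>I. \<Sum>y\<in>I. cnj (f x) * rho x y * f y) =
         of_real (\<Sum>i\<in>I. l i * (cmod (\<Sum>y\<in>I. cnj (v i y) * f y))\<^sup>2)"
proof -
  define c where "c i = (\<Sum>y\<in>I. cnj (v i y) * f y)" for i
  have "(\<Sum>x\<in>I. \<Sum>y\<in>I. cnj (f x) * rho x y * f y) =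
      (\<Sum>x\<in>I. \<Sum>y\<in>I. \<Sum>i\<in>I. of_real (l i) * ((cnj (f x) * v i x) * (cnj (v i y) * f y)))"
    by (intro sum.cong refl)
       (simp add: eigenbasis_decomposition[OF fin ev] sum_distrib_left sum_distrib_right mult_ac)
  also have "\<dots> = (\<Sum>x\<in>I. \<Sum>i\<in>I. \<Sum>y\<in>I. of_real (l i) * ((cnj (f x) * v i x) * (cnj (v i y) * f y)))"
    by (intro sum.cong refl sum.swap)
  also have "\<dots> = (\<Sum>i\<in>I. \<Sum>x\<in>I. \<Sum>y\<in>I. of_real (l i) * ((cnj (f x) * v i x) * (cnj (v i y) * f y)))"
    by (rule sum.swap)
  also have "\<dots> = (\<Sum>i\<in>I. of_real (l i) * ((\<Sum>x\<in>I. cnj (f x) * v i x) * c i))"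
    unfolding c_def sum_product by (simp only: sum_distrib_left)
  also have "\<dots> = (\<Sum>i\<in>I. of_real (l i) * (cnj (c i) * c i))"
    by (simp add: c_def mult.commute)
  also have "\<dots> = of_real (\<Sum>i\<in>I. l i * (cmod (c i))\<^sup>2)"
    by (simp add: complex_norm_square mult.commute del: of_real_power)
  finally show ?thesis by (simp only: c_def)
qed

text \<open>Every orthonormal basis is an eigenbasis of the identity with all eigenvalues 1, so this
  is a case of the diagonalized form.\<close>

lemma Parseval:
  assumes fin: "finite I" and v: "orthonormal_basis I v"
  shows "(\<Sum>i\<in>I. (cmod (\<Sum>y\<in>I. cnj (v i y) * f y))\<^sup>2) = (\<Sum>x\<in>I. (cmod (f x))\<^sup>2)"
proof -
  have "eigenbasis I (\<lambda>x y. if x = y then 1 else 0) (\<lambda>_. 1) v"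
    using v fin by (simp add: eigenbasis_def sum_delta_mult)
  from eigenbasis_quadratic_form[OF fin this, of f]
  have "complex_of_real (\<Sum>i\<in>I. (cmod (\<Sum>y\<in>I. cnj (v i y) * f y))\<^sup>2) =
      (\<Sum>x\<in>I. \<Sum>y\<in>I. cnj (f x) * (if x = y then 1 else 0) * f y)"
    by simp
  also have "\<dots> = (\<Sum>x\<in>I. cnj (f x) * f x)"
    using fin by (intro sum.cong refl) (simp add: mult.assoc sum_distrib_left[symmetric] sum_delta_mult)
  also have "\<dots> = complex_of_real (\<Sum>x\<in>I. (cmod (f x))\<^sup>2)"
    by (simp add: complex_norm_square mult.commute del: of_real_power)
  finally show ?thesis using of_real_eq_iff by blast
qed

lemma eigenbasis_trace:
  assumes fin: "finite I" and ev: "eigenbasis I rho l v"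
  shows "(\<Sum>i\<in>I. rho i i) = of_real (\<Sum>j\<in>I. l j)"
proof -
  have "(\<Sum>i\<in>I. rho i i) = (\<Sum>i\<in>I. \<Sum>j\<in>I. of_real (l j) * (cnj (v j i) * v j i))"
    by (intro sum.cong refl) (simp add: eigenbasis_decomposition[OF fin ev] mult_ac)
  also have "\<dots> = (\<Sum>j\<in>I. \<Sum>i\<in>I. of_real (l j) * (cnj (v j i) * v j i))" by (rule sum.swap)
  also have "\<dots> = (\<Sum>j\<in>I. of_real (l j))"
    using ev by (intro sum.cong refl) (simp add: sum_distrib_left[symmetric] eigenbasis_def orthonormal_basis_def)
  finally show ?thesis by simp
qed

subsection \<open>Concavity of the entropy and its equality case\<close>

text \<open>The inequality constrains only the real part of the form, so Hermitian symmetry is a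
  separate conjunct.\<close>

definition psd_on :: "'i set \<Rightarrow> ('i \<Rightarrow> 'i \<Rightarrow> complex) \<Rightarrow> bool" where
  "psd_on I rho \<longleftrightarrow> hermitian_on I rho \<and>
     (\<forall>u. 0 \<le> Re (\<Sum>i\<in>I. \<Sum>k\<in>I. cnj (u i) * rho i k * u k))"

text \<open>The form is a sum of squared moduli. Reduced operators of pure vectors have this
  shape.\<close>

lemma psd_on_Gram: "psd_on I (\<lambda>i i'. \<Sum>t\<in>T. g i t * cnj (g i' t))"
proof -
  have "(\<Sum>i\<in>I. \<Sum>k\<in>I. cnj (u i) * (\<Sum>t\<in>T. g i t * cnj (g k t)) * u k) =
      of_real (\<Sum>t\<in>T. (cmod (\<Sum>i\<in>I. cnj (u i) * g i t))\<^sup>2)" for u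
  proof -
    have "(\<Sum>i\<in>I. \<Sum>k\<in>I. cnj (u i) * (\<Sum>t\<in>T. g i t * cnj (g k t)) * u k) =
       (\<Sum>i\<in>I. \<Sum>k\<in>I. \<Sum>t\<in>T. (cnj (u i) * g i t) * (u k * cnj (g k t)))"
      by (simp add: sum_distrib_left sum_distrib_right mult_ac)
    also have "\<dots> = (\<Sum>i\<in>I. \<Sum>t\<in>T. \<Sum>k\<in>I. (cnj (u i) * g i t) * (u k * cnj (g k t)))"
      by (intro sum.cong refl sum.swap)
    also have "\<dots> = (\<Sum>t\<in>T. \<Sum>i\<in>I. \<Sum>k\<in>I. (cnj (u i) * g i t) * (u k * cnj (g k t)))"
      by (rule sum.swap)
    also have "\<dots> = (\<Sum>t\<in>T. (\<Sum>i\<in>I. cnj (u i) * g i t) * cnj (\<Sum>i\<in>I. cnj (u i) * g i t))"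
      unfolding sum_product[symmetric] by simp
    finally show ?thesis by (simp add: complex_norm_square del: of_real_power)
  qed
  then have "0 \<le> Re (\<Sum>i\<in>I. \<Sum>k\<in>I. cnj (u i) * (\<Sum>t\<in>T. g i t * cnj (g k t)) * u k)" for u
    by (simp add: sum_nonneg)
  then show ?thesis
    by (simp add: psd_on_def hermitian_on_def mult.commute)
qed

lemma psd_on_sum:
  assumes "\<And>k. k \<in> K \<Longrightarrow> psd_on I (R k)"
  shows "psd_on I (\<lambda>i i'. \<Sum>k\<in>K. R k i i')"
  unfolding psd_on_def
proof (intro conjI allI)
  have "R k j i = cnj (R k i j)" if "k \<in> K" "i \<in> I" "j \<in> I" for k i j
    using assms that hermitian_onD unfolding psd_on_def by metis
  then show "hermitian_on I (\<lambda>i i'. \<Sum>k\<in>K. R k i i')"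
    unfolding hermitian_on_def cnj_sum by (intro ballI sum.cong refl) blast
  fix u
  have "(\<Sum>i\<in>I. \<Sum>j\<in>I. cnj (u i) * (\<Sum>k\<in>K. R k i j) * u j) =
      (\<Sum>i\<in>I. \<Sum>j\<in>I. \<Sum>k\<in>K. cnj (u i) * R k i j * u j)"
    by (simp add: sum_distrib_left sum_distrib_right)
  also have "\<dots> = (\<Sum>i\<in>I. \<Sum>k\<in>K. \<Sum>j\<in>I. cnj (u i) * R k i j * u j)"
    by (intro sum.cong refl sum.swap)
  also have "\<dots> = (\<Sum>k\<in>K. \<Sum>i\<in>I. \<Sum>j\<in>I. cnj (u i) * R k i j * u j)"
    by (rule sum.swap)
  finally have "Re (\<Sum>i\<in>I. \<Sum>j\<in>I. cnj (u i) * (\<Sum>k\<in>K. R k i j) * u j) =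
      (\<Sum>k\<in>K. Re (\<Sum>i\<in>I. \<Sum>j\<in>I. cnj (u i) * R k i j * u j))" by simp
  also have "\<dots> \<ge> 0" using assms unfolding psd_on_def by (intro sum_nonneg) blast
  finally show "0 \<le> Re (\<Sum>i\<in>I. \<Sum>j\<in>I. cnj (u i) * (\<Sum>k\<in>K. R k i j) * u j)" .
qed

text \<open>The delta inside \<open>cmod\<close> is the overlap of an orthonormal basis with one of
  its own vectors.\<close>

lemma sum_norm_delta:
  assumes "finite I" "j \<in> I"
  shows "(\<Sum>i\<in>I. f i * (cmod (if i = j then 1 else 0))\<^sup>2) = f j"
proof -
  have "(\<Sum>i\<in>I. f i * (cmod (if i = j then 1 else 0))\<^sup>2) = (\<Sum>i\<in>I. f i * (if i = j then 1 else 0))"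
    by (intro sum.cong) auto
  then show ?thesis using assms by (simp only: sum_delta_mult)
qed

text \<open>Each eigenvalue is the value of the form at its own eigenvector.\<close>

lemma psd_on_eigenbasis:
  assumes fin: "finite I" and psd: "psd_on I rho"
  obtains l v where "eigenbasis I rho l v" "\<And>j. j \<in> I \<Longrightarrow> 0 \<le> l j"
proof -
  obtain l v where ev: "eigenbasis I rho l v"
    using spectral_theorem[OF fin] psd unfolding psd_on_def by metis
  moreover have "0 \<le> l j" if "j \<in> I" for j
  proof -
    have "(\<Sum>x\<in>I. \<Sum>y\<in>I. cnj (v j x) * rho x y * v j y) =
        of_real (\<Sum>i\<in>I. l i * (cmod (if i = j then 1 else 0))\<^sup>2)"
      using ev that unfolding eigenbasis_quadratic_form[OF fin ev]
      by (intro arg_cong[where f = of_real] sum.cong refl) (simp add: eigenbasis_def orthonormal_basis_def)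
    also have "(\<Sum>i\<in>I. l i * (cmod (if i = j then 1 else 0))\<^sup>2) = l j"
      using fin that by (rule sum_norm_delta)
    finally have "(\<Sum>x\<in>I. \<Sum>y\<in>I. cnj (v j x) * rho x y * v j y) = of_real (l j)" .
    moreover have "0 \<le> Re (\<Sum>x\<in>I. \<Sum>y\<in>I. cnj (v j x) * rho x y * v j y)"
      using psd[unfolded psd_on_def, THEN conjunct2, rule_format] .
    ultimately show ?thesis by simp
  qed
  ultimately show ?thesis using that by blast
qed

lemma eta_scale: "c > 0 \<Longrightarrow> p \<ge> 0 \<Longrightarrow> eta (c * p) = c * eta p - c * log 2 c * p"
  by (cases "p = 0") (auto simp: eta_def mult_le_0_iff log_mult_pos algebra_simps)

text \<open>The operators are unnormalized, so rescaling also costs a multiple of the trace,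
  obtained by summing \<open>eta_scale\<close> over the eigenvalues.\<close>

lemma vn_entropy_scale:
  assumes fin: "finite I" and psd: "psd_on I rho" and c: "c > 0"
  shows "vn_entropy I (\<lambda>i j. of_real c * rho i j) =
         c * vn_entropy I rho - c * log 2 c * Re (\<Sum>i\<in>I. rho i i)"
proof -
  obtain l v where ev: "eigenbasis I rho l v" and l: "\<And>j. j \<in> I \<Longrightarrow> 0 \<le> l j"
    using psd_on_eigenbasis[OF fin psd] by metis
  have "eigenbasis I (\<lambda>i j. of_real c * rho i j) (\<lambda>j. c * l j) v"
    using ev by (simp add: eigenbasis_def mult.assoc sum_distrib_left[symmetric])
  then have "vn_entropy I (\<lambda>i j. of_real c * rho i j) = (\<Sum>j\<in>I. c * eta (l j) - c * log 2 c * l j)"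
    by (simp add: vn_entropy_eigenbasis[OF fin] eta_scale c l)
  then show ?thesis
    by (simp add: vn_entropy_eigenbasis[OF fin ev] eigenbasis_trace[OF fin ev]
        sum_subtractf sum_distrib_left)
qed

text \<open>The bound is the tangent of the concave function \<open>eta\<close> at \<open>b\<close>,
  evaluated at \<open>a\<close>. For positive \<open>a\<close> and \<open>t = b / a\<close>, the gap
  is a positive multiple of \<open>t - 1 - ln t\<close>, which vanishes only at
  \<open>t = 1\<close>.\<close>

lemma eta_tangent:
  assumes "a \<ge> 0" "b > 0"
  shows "eta a \<le> (b - a) / ln 2 - a * log 2 b \<and> (eta a = (b - a) / ln 2 - a * log 2 b \<longrightarrow> a = b)"
proof (cases "a = 0")
  case True
  then show ?thesis using assms by (simp add: eta_def)
next
  case False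
  then have a: "a > 0" using assms by simp
  have gap: "(b - a) / ln 2 - a * log 2 b - eta a = a * ((b / a - 1) - ln (b / a)) / ln 2"
    using a assms by (simp add: eta_def log_def ln_div field_simps)
  let ?g = "a * ((b / a - 1) - ln (b / a)) / ln 2"
  have "ln (b / a) \<le> b / a - 1" using a assms by (intro ln_le_minus_one) simp
  then have "0 \<le> ?g" using a by simp
  moreover have "a = b" if "?g = 0"
    using that ln_eq_minus_one[of "b / a"] a assms by simp
  ultimately show ?thesis using gap by (intro conjI impI) linarith+
qed

text \<open>Klein's inequality summed over \<open>k\<close>: the deficit is the sum of the relative
  entropies of \<open>R k\<close> with respect to \<open>T\<close> divided by \<open>card K\<close>.
  In eigenbases it is a sum of tangent gaps of \<open>eta\<close>, weighted by squared overlaps of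
  eigenvectors; equality makes each weighted gap vanish.\<close>

lemma vn_entropy_sum:
  fixes R :: "'k \<Rightarrow> 'i \<Rightarrow> 'i \<Rightarrow> complex"
  assumes fin: "finite I" and K: "finite K" "K \<noteq> {}" and psd: "\<And>k. k \<in> K \<Longrightarrow> psd_on I (R k)"
  defines "T \<equiv> \<lambda>i j. \<Sum>k\<in>K. R k i j"
  defines "bound \<equiv> vn_entropy I T + log 2 (card K) * Re (\<Sum>i\<in>I. T i i)"
  shows "(\<Sum>k\<in>K. vn_entropy I (R k)) \<le> bound \<and>
    ((\<Sum>k\<in>K. vn_entropy I (R k)) = bound \<longrightarrow>
       (\<forall>k\<in>K. \<forall>i\<in>I. \<forall>j\<in>I. R k i j = T i j / of_nat (card K)))"
proof -
  define n where "n = real (card K)"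
  have n: "n > 0" using K by (simp add: n_def card_gt_0_iff)
  have "psd_on I T" unfolding T_def using psd by (rule psd_on_sum)
  then obtain m w where w: "eigenbasis I T m w" and m: "\<And>j. j \<in> I \<Longrightarrow> 0 \<le> m j"
    using psd_on_eigenbasis[OF fin] by metis
  have wo: "orthonormal_basis I w" using w by (simp add: eigenbasis_def)
  have "\<exists>lv. \<forall>k\<in>K. eigenbasis I (R k) (fst (lv k)) (snd (lv k)) \<and> (\<forall>j\<in>I. 0 \<le> fst (lv k) j)"
  proof (intro bchoice ballI)
    fix k assume "k \<in> K"
    obtain l v where "eigenbasis I (R k) l v" "\<And>j. j \<in> I \<Longrightarrow> 0 \<le> l j"
      using psd_on_eigenbasis[OF fin psd[OF \<open>k \<in> K\<close>]] by metis
    then show "\<exists>lv. eigenbasis I (R k) (fst lv) (snd lv) \<and> (\<forall>j\<in>I. 0 \<le> fst lv j)"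
      by (intro exI[of _ "(l, v)"]) simp
  qed
  then obtain lv where lv: "\<And>k. k \<in> K \<Longrightarrow> eigenbasis I (R k) (fst (lv k)) (snd (lv k))"
    "\<And>k j. k \<in> K \<Longrightarrow> j \<in> I \<Longrightarrow> 0 \<le> fst (lv k) j" by blast
  define l where "l k = fst (lv k)" for k
  define v where "v k = snd (lv k)" for k
  have v: "eigenbasis I (R k) (l k) (v k)" if "k \<in> K" for k using lv(1)[OF that] by (simp add: l_def v_def)
  have l: "0 \<le> l k j" if "k \<in> K" "j \<in> I" for k j using lv(2)[OF that] by (simp add: l_def)
  have vo: "orthonormal_basis I (v k)" if "k \<in> K" for k using v[OF that] by (simp add: eigenbasis_def)
  define c where "c k i j = (\<Sum>x\<in>I. cnj (v k i x) * w j x)" for k i j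
  \<comment> \<open>Squared overlaps of two orthonormal bases form a doubly stochastic matrix, by
    Parseval in either direction (\<open>p1\<close> and \<open>p2\<close>).\<close>
  define p where "p k i j = (cmod (c k i j))\<^sup>2" for k i j
  have p0: "0 \<le> p k i j" for k i j by (simp add: p_def)
  have p1: "(\<Sum>i\<in>I. p k i j) = 1" if "k \<in> K" "j \<in> I" for k j
    using Parseval[OF fin vo[OF that(1)], of "w j"] orthonormal_basis_norm[OF wo that(2)]
    by (simp add: p_def c_def)
  have p2: "(\<Sum>j\<in>I. p k i j) = 1" if "k \<in> K" "i \<in> I" for k i
  proof -
    have "cmod (c k i j) = cmod (\<Sum>x\<in>I. cnj (w j x) * v k i x)" for j
      unfolding c_def by (subst complex_mod_cnj[symmetric]) (simp add: mult.commute)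
    then show ?thesis
      using Parseval[OF fin wo, of "v k i"] orthonormal_basis_norm[OF vo[OF that(1)] that(2)]
      by (simp add: p_def)
  qed
  \<comment> \<open>These are the eigenvalues of \<open>T / n\<close>, the operator that every
    \<open>R k\<close> has to equal in the equality case.\<close>
  define b where "b j = m j / n" for j
  have b0: "0 \<le> b j" if "j \<in> I" for j using m[OF that] n by (simp add: b_def)
  \<comment> \<open>Both sides are the quadratic form of \<open>T\<close> at \<open>w j\<close>; the
    left one evaluates it through the eigenbases of the summands.\<close>
  have pm: "(\<Sum>k\<in>K. \<Sum>i\<in>I. p k i j * l k i) = m j" if j: "j \<in> I" for j
  proof -
    have "complex_of_real (m j) = of_real (\<Sum>i\<in>I. m i * (cmod (if i = j then 1 else 0))\<^sup>2)"
      using sum_norm_delta[OF fin j] by simp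
    also have "\<dots> = (\<Sum>x\<in>I. \<Sum>y\<in>I. cnj (w j x) * T x y * w j y)"
      using wo j unfolding eigenbasis_quadratic_form[OF fin w]
      by (intro arg_cong[where f = of_real] sum.cong refl) (simp add: orthonormal_basis_def)
    also have "\<dots> = (\<Sum>x\<in>I. \<Sum>y\<in>I. \<Sum>k\<in>K. cnj (w j x) * R k x y * w j y)"
      by (simp add: T_def sum_distrib_left sum_distrib_right)
    also have "\<dots> = (\<Sum>x\<in>I. \<Sum>k\<in>K. \<Sum>y\<in>I. cnj (w j x) * R k x y * w j y)"
      by (intro sum.cong refl sum.swap)
    also have "\<dots> = (\<Sum>k\<in>K. \<Sum>x\<in>I. \<Sum>y\<in>I. cnj (w j x) * R k x y * w j y)"
      by (rule sum.swap)
    also have "\<dots> = (\<Sum>k\<in>K. of_real (\<Sum>i\<in>I. l k i * p k i j))"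
      by (intro sum.cong refl) (simp only: eigenbasis_quadratic_form[OF fin v] p_def c_def)
    finally have "complex_of_real (m j) = of_real (\<Sum>k\<in>K. \<Sum>i\<in>I. l k i * p k i j)" by simp
    then show ?thesis using of_real_eq_iff by (metis (no_types, lifting) mult.commute sum.cong)
  qed
  \<comment> \<open>Where \<open>T\<close> has eigenvalue 0 no tangent is available. There the
    nonnegative terms of \<open>pm\<close> sum to zero, so the overlap or the eigenvalue of
    \<open>R k\<close> vanishes.\<close>
  have pl0: "p k i j * l k i = 0" if "b j = 0" "k \<in> K" "i \<in> I" "j \<in> I" for k i j
  proof -
    have "(\<Sum>k\<in>K. \<Sum>i\<in>I. p k i j * l k i) = 0"
      using pm[OF that(4)] that(1) n by (simp add: b_def)
    then have "(\<Sum>i\<in>I. p k i j * l k i) = 0"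
      using that(2) K(1) by (subst (asm) sum_nonneg_eq_0_iff) (auto intro!: sum_nonneg simp: l p0)
    then show ?thesis
      using that(2,3) fin by (subst (asm) sum_nonneg_eq_0_iff) (auto simp: l p0)
  qed
  define gap where "gap k i j = p k i j * ((b j - l k i) / ln 2 - l k i * log 2 (b j) - eta (l k i))" for k i j
  \<comment> \<open>The equation between \<open>l k i\<close> and \<open>b j\<close> is multiplied
    by the overlap \<open>c k i j\<close>, so that it also holds when the gap vanishes through a
    zero weight.\<close>
  have gap0: "0 \<le> gap k i j \<and> (gap k i j = 0 \<longrightarrow> of_real (l k i) * c k i j = of_real (b j) * c k i j)"
    if "k \<in> K" "i \<in> I" "j \<in> I" for k i j
  proof (cases "b j = 0")
    case True
    then have "p k i j = 0 \<or> l k i = 0" using pl0 that by simp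
    then show ?thesis using True by (auto simp: gap_def p_def eta_def)
  next
    case False
    then have "b j > 0" using b0 that by fastforce
    note tan = eta_tangent[OF l[OF that(1,2)] this]
    have "0 \<le> gap k i j" unfolding gap_def using tan p0 by (intro mult_nonneg_nonneg) auto
    moreover have "gap k i j = 0 \<Longrightarrow> p k i j = 0 \<or> l k i = b j" using tan by (auto simp: gap_def)
    ultimately show ?thesis by (auto simp: p_def)
  qed
  \<comment> \<open>The linear parts of the tangents give traces that cancel after summation over
    \<open>k\<close>; the logarithmic parts give the entropy of \<open>T\<close> and
    \<open>log 2 n\<close> times its trace.\<close>
  have eq: "bound - (\<Sum>k\<in>K. vn_entropy I (R k)) = (\<Sum>k\<in>K. \<Sum>i\<in>I. \<Sum>j\<in>I. gap k i j)"
  proof -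
    have e1: "(\<Sum>i\<in>I. \<Sum>j\<in>I. gap k i j) = (\<Sum>j\<in>I. b j / ln 2) - (\<Sum>i\<in>I. l k i) / ln 2
        - (\<Sum>j\<in>I. (\<Sum>i\<in>I. p k i j * l k i) * log 2 (b j)) - vn_entropy I (R k)" if k: "k \<in> K" for k
    proof -
      have "(\<Sum>i\<in>I. \<Sum>j\<in>I. gap k i j) = (\<Sum>i\<in>I. \<Sum>j\<in>I. p k i j * (b j / ln 2) - p k i j * (l k i / ln 2)
          - (p k i j * l k i) * log 2 (b j) - p k i j * eta (l k i))"
        by (intro sum.cong refl) (simp add: gap_def diff_divide_distrib right_diff_distrib)
      also have "\<dots> = (\<Sum>i\<in>I. \<Sum>j\<in>I. p k i j * (b j / ln 2)) - (\<Sum>i\<in>I. \<Sum>j\<in>I. p k i j * (l k i / ln 2))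
          - (\<Sum>i\<in>I. \<Sum>j\<in>I. (p k i j * l k i) * log 2 (b j)) - (\<Sum>i\<in>I. \<Sum>j\<in>I. p k i j * eta (l k i))"
        by (simp only: sum_subtractf)
      also have "(\<Sum>i\<in>I. \<Sum>j\<in>I. p k i j * (b j / ln 2)) = (\<Sum>j\<in>I. b j / ln 2)"
        by (subst sum.swap) (simp add: sum_distrib_right[symmetric] p1 k del: times_divide_eq_right)
      also have "(\<Sum>i\<in>I. \<Sum>j\<in>I. p k i j * (l k i / ln 2)) = (\<Sum>i\<in>I. l k i) / ln 2"
        by (simp add: sum_distrib_right[symmetric] p2 k sum_divide_distrib del: times_divide_eq_right)
      also have "(\<Sum>i\<in>I. \<Sum>j\<in>I. (p k i j * l k i) * log 2 (b j)) = (\<Sum>j\<in>I. (\<Sum>i\<in>I. p k i j * l k i) * log 2 (b j))"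
        by (subst sum.swap) (simp only: sum_distrib_right)
      also have "(\<Sum>i\<in>I. \<Sum>j\<in>I. p k i j * eta (l k i)) = vn_entropy I (R k)"
        by (simp add: sum_distrib_right[symmetric] p2 k vn_entropy_eigenbasis[OF fin v[OF k]])
      finally show ?thesis .
    qed
    have tr: "(\<Sum>k\<in>K. \<Sum>i\<in>I. l k i) = (\<Sum>j\<in>I. m j)"
    proof -
      have "complex_of_real (\<Sum>k\<in>K. \<Sum>i\<in>I. l k i) = (\<Sum>k\<in>K. \<Sum>x\<in>I. R k x x)"
        by (simp add: eigenbasis_trace[OF fin v])
      also have "\<dots> = (\<Sum>x\<in>I. T x x)" unfolding T_def by (rule sum.swap)
      also have "\<dots> = complex_of_real (\<Sum>j\<in>I. m j)" by (rule eigenbasis_trace[OF fin w])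
      finally show ?thesis using of_real_eq_iff by blast
    qed
    have lg: "m j * log 2 (b j) = - eta (m j) - log 2 n * m j" if "j \<in> I" for j
      using m[OF that] n by (cases "m j = 0") (auto simp: b_def eta_def log_divide_pos algebra_simps)
    have "(\<Sum>k\<in>K. \<Sum>i\<in>I. \<Sum>j\<in>I. gap k i j) =
        n * (\<Sum>j\<in>I. b j / ln 2) - (\<Sum>k\<in>K. \<Sum>i\<in>I. l k i) / ln 2
        - (\<Sum>k\<in>K. \<Sum>j\<in>I. (\<Sum>i\<in>I. p k i j * l k i) * log 2 (b j)) - (\<Sum>k\<in>K. vn_entropy I (R k))"
      by (simp add: e1 sum_subtractf sum_divide_distrib n_def)
    also have "(\<Sum>k\<in>K. \<Sum>j\<in>I. (\<Sum>i\<in>I. p k i j * l k i) * log 2 (b j)) = (\<Sum>j\<in>I. m j * log 2 (b j))"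
      by (subst sum.swap) (simp add: sum_distrib_right[symmetric] pm)
    also have "\<dots> = - vn_entropy I T - log 2 n * (\<Sum>j\<in>I. m j)"
      by (simp add: lg vn_entropy_eigenbasis[OF fin w] sum_subtractf sum_negf sum_distrib_left)
    also have "n * (\<Sum>j\<in>I. b j / ln 2) = (\<Sum>j\<in>I. m j) / ln 2"
      using n by (simp add: sum_distrib_left sum_divide_distrib b_def)
    finally show ?thesis
      by (simp add: tr bound_def eigenbasis_trace[OF fin w] n_def)
  qed
  have "(\<Sum>k\<in>K. vn_entropy I (R k)) \<le> bound"
  proof -
    have "0 \<le> (\<Sum>k\<in>K. \<Sum>i\<in>I. \<Sum>j\<in>I. gap k i j)" using gap0 by (intro sum_nonneg) blast
    then show ?thesis using eq by linarith
  qed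
  moreover have "R k i j = T i j / of_nat (card K)"
    if e: "(\<Sum>k\<in>K. vn_entropy I (R k)) = bound" and k: "k \<in> K" and ij: "i \<in> I" "j \<in> I" for k i j
  proof -
    have "(\<Sum>k\<in>K. \<Sum>i\<in>I. \<Sum>j\<in>I. gap k i j) = 0" using eq e by simp
    then have "(\<Sum>i\<in>I. \<Sum>j\<in>I. gap k i j) = 0"
      using k K(1) by (subst (asm) sum_nonneg_eq_0_iff) (auto intro!: sum_nonneg simp: gap0)
    then have g: "(\<Sum>j\<in>I. gap k i j) = 0" if "i \<in> I" for i
      using k fin that by (subst (asm) sum_nonneg_eq_0_iff) (auto intro!: sum_nonneg simp: gap0)
    have "gap k i j = 0" if "i \<in> I" "j \<in> I" for i j
      using g[OF that(1)] k fin that by (subst (asm) sum_nonneg_eq_0_iff) (auto simp: gap0)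
    then have lc: "of_real (l k i) * c k i j = of_real (b j) * c k i j" if "i \<in> I" "j \<in> I" for i j
      using gap0 k that by blast
    \<comment> \<open>Expanding \<open>w j\<close> in the eigenvectors of \<open>R k\<close>, only
      those with eigenvalue \<open>b j\<close> occur. Hence \<open>R k\<close> and
      \<open>T / n\<close> share their spectral decomposition.\<close>
    have "eigenbasis I (R k) b w"
      unfolding eigenbasis_def
    proof (intro conjI ballI wo)
      fix j x assume j: "j \<in> I" and x: "x \<in> I"
      have "(\<Sum>y\<in>I. R k x y * w j y) = (\<Sum>y\<in>I. \<Sum>i\<in>I. of_real (l k i) * v k i x * (cnj (v k i y) * w j y))"
        by (intro sum.cong refl)
           (simp add: eigenbasis_decomposition[OF fin v[OF k] x] sum_distrib_right mult.assoc)
      also have "\<dots> = (\<Sum>i\<in>I. \<Sum>y\<in>I. of_real (l k i) * v k i x * (cnj (v k i y) * w j y))"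
        by (rule sum.swap)
      also have "\<dots> = (\<Sum>i\<in>I. of_real (l k i) * v k i x * c k i j)"
        by (simp only: c_def sum_distrib_left)
      also have "\<dots> = (\<Sum>i\<in>I. of_real (b j) * (v k i x * c k i j))"
        using lc j by (intro sum.cong refl) (metis mult.assoc mult.commute)
      also have "\<dots> = of_real (b j) * w j x"
        unfolding sum_distrib_left[symmetric] c_def
        using orthonormal_basis_expand[OF fin vo[OF k] x, of "w j"] by simp
      finally show "(\<Sum>y\<in>I. R k x y * w j y) = complex_of_real (b j) * w j x" .
    qed
    from eigenbasis_decomposition[OF fin this ij]
    have "R k i j = (\<Sum>s\<in>I. of_real (m s) * w s i * cnj (w s j)) / of_real n"
      by (simp add: b_def sum_divide_distrib)
    then show ?thesis
      using eigenbasis_decomposition[OF fin w ij] by (simp add: n_def)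
  qed
  ultimately show ?thesis by blast
qed

subsection \<open>Entropies of the four registers\<close>

text \<open>\<open>sub_basis\<close> sets the coordinates outside \<open>K\<close> to 0; giving them
  the range \<open>{0}\<close> turns it into a product of four ranges.\<close>

definition reg_range :: "nat set \<Rightarrow> nat \<Rightarrow> nat \<Rightarrow> nat set" where
  "reg_range K j n = (if j \<in> K then {..<n} else {0})"

lemma sub_basis_four:
  "sub_basis [n0, n1, n2, n3] K = (\<lambda>(x, a, y, b). [x, a, y, b]) `
     (reg_range K 0 n0 \<times> reg_range K 1 n1 \<times> reg_range K 2 n2 \<times> reg_range K 3 n3)"
proof -
  have iff: "[x, a, y, b] \<in> sub_basis [n0, n1, n2, n3] K \<longleftrightarrow>
      x \<in> reg_range K 0 n0 \<and> a \<in> reg_range K 1 n1 \<and> y \<in> reg_range K 2 n2 \<and> b \<in> reg_range K 3 n3"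
    for x a y b
    by (simp add: sub_basis_def reg_range_def numeral_eq_Suc All_less_Suc conj_ac)
  have "\<exists>x a y b. ks = [x, a, y, b]" if "ks \<in> sub_basis [n0, n1, n2, n3] K" for ks
  proof -
    have "length ks = 4" using that by (simp add: sub_basis_def)
    then show ?thesis by (auto simp: length_Suc_conv numeral_eq_Suc)
  qed
  then show ?thesis using iff by (fastforce simp: image_iff)
qed

lemma sum_sub_basis_four:
  "(\<Sum>ks\<in>sub_basis [n0, n1, n2, n3] K. f ks) =
   (\<Sum>x\<in>reg_range K 0 n0. \<Sum>a\<in>reg_range K 1 n1. \<Sum>y\<in>reg_range K 2 n2. \<Sum>b\<in>reg_range K 3 n3. f [x, a, y, b])"
  unfolding sub_basis_four
  by (subst sum.reindex) (auto simp: inj_on_def sum.cartesian_product intro!: sum.cong)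

lemma merge_regs_four:
  "merge_regs K [x, a, y, b] [x', a', y', b'] =
     [if 0 \<in> K then x else x', if 1 \<in> K then a else a', if 2 \<in> K then y else y', if 3 \<in> K then b else b']"
  by (simp add: merge_regs_def numeral_eq_Suc upt_rec)

lemmas reduced_op_four = reduced_op_def sum_sub_basis_four merge_regs_four reg_range_def

lemma bij_betw_sub_basis_four:
  assumes "g ` J = (\<lambda>(x, a, y, b). [x, a, y, b]) `
     (reg_range K 0 n0 \<times> reg_range K 1 n1 \<times> reg_range K 2 n2 \<times> reg_range K 3 n3)" "inj_on g J"
  shows "bij_betw g J (sub_basis [n0, n1, n2, n3] K)"
  using assms by (simp add: bij_betw_def sub_basis_four)

section \<open>Entropies of groups of registers, split along the measured ones\<close>

lemma ent_X:
  "ent psi [nx, da, ny, db] {0} {0} = (\<Sum>x<nx. eta (\<Sum>a<da. \<Sum>y<ny. \<Sum>b<db. (cmod (psi [x, a, y, b]))\<^sup>2))"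
proof -
  have "ent psi [nx, da, ny, db] {0} {0} =
      vn_entropy {..<nx} (\<lambda>x x'. reduced_op psi [nx, da, ny, db] {0} {0} [x, 0, 0, 0] [x', 0, 0, 0])"
    unfolding ent_def
    by (rule vn_entropy_reindex, simp, rule bij_betw_sub_basis_four)
       (auto simp: reg_range_def image_iff inj_on_def)
  also have "\<dots> = (\<Sum>x<nx. eta (Re (of_real (\<Sum>a<da. \<Sum>y<ny. \<Sum>b<db. (cmod (psi [x, a, y, b]))\<^sup>2))))"
    by (rule vn_entropy_diagonal)
       (auto simp: reduced_op_four complex_norm_square simp del: of_real_power)
  finally show ?thesis by simp
qed

lemma ent_Y:
  "ent psi [nx, da, ny, db] {2} {2} = (\<Sum>y<ny. eta (\<Sum>x<nx. \<Sum>a<da. \<Sum>b<db. (cmod (psi [x, a, y, b]))\<^sup>2))"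
proof -
  have "ent psi [nx, da, ny, db] {2} {2} =
      vn_entropy {..<ny} (\<lambda>y y'. reduced_op psi [nx, da, ny, db] {2} {2} [0, 0, y, 0] [0, 0, y', 0])"
    unfolding ent_def
    by (rule vn_entropy_reindex, simp, rule bij_betw_sub_basis_four)
       (auto simp: reg_range_def image_iff inj_on_def)
  also have "\<dots> = (\<Sum>y<ny. eta (Re (of_real (\<Sum>x<nx. \<Sum>a<da. \<Sum>b<db. (cmod (psi [x, a, y, b]))\<^sup>2))))"
    by (rule vn_entropy_diagonal)
       (auto simp: reduced_op_four complex_norm_square simp del: of_real_power)
  finally show ?thesis by simp
qed

text \<open>In these names \<open>W\<close> is a work space: \<open>BW\<close> is BB',
  \<open>AW\<close> is AA', \<open>YW\<close> is YB', \<open>XW\<close> is XA', while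
  \<open>XYW\<close> adds B' and \<open>YXW\<close> adds A' to the pair. Leaving \<open>M\<close>
  open lets one reindexing serve measured and unmeasured registers.\<close>

lemma ent_BW:
  "ent psi [nx, da, ny, db] {2, 3} M = vn_entropy ({..<ny} \<times> {..<db})
     (\<lambda>yb yb'. reduced_op psi [nx, da, ny, db] {2, 3} M [0, 0, fst yb, snd yb] [0, 0, fst yb', snd yb'])"
  unfolding ent_def
  by (rule vn_entropy_reindex, simp, rule bij_betw_sub_basis_four)
     (auto simp: reg_range_def image_iff inj_on_def)

lemma ent_AW:
  "ent psi [nx, da, ny, db] {0, 1} M = vn_entropy ({..<nx} \<times> {..<da})
     (\<lambda>xa xa'. reduced_op psi [nx, da, ny, db] {0, 1} M [fst xa, snd xa, 0, 0] [fst xa', snd xa', 0, 0])"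
  unfolding ent_def
  by (rule vn_entropy_reindex, simp, rule bij_betw_sub_basis_four)
     (auto simp: reg_range_def image_iff inj_on_def)

lemma ent_XBW:
  "ent psi [nx, da, ny, db] {0, 2, 3} M = vn_entropy ({..<nx} \<times> {..<ny} \<times> {..<db})
     (\<lambda>(x, y, b) (x', y', b'). reduced_op psi [nx, da, ny, db] {0, 2, 3} M [x, 0, y, b] [x', 0, y', b'])"
  unfolding ent_def
  by (subst vn_entropy_reindex[of "{..<nx} \<times> {..<ny} \<times> {..<db}" "\<lambda>(x, y, b). [x, 0, y, b]"], simp, rule bij_betw_sub_basis_four)
     (auto simp: reg_range_def image_iff inj_on_def case_prod_unfold)

text \<open>Register 2 comes first in the index because \<open>vn_entropy_blocks\<close> splits
  along the first component, and here it is Y that gets measured.\<close>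

lemma ent_YAW:
  "ent psi [nx, da, ny, db] {0, 1, 2} M = vn_entropy ({..<ny} \<times> {..<nx} \<times> {..<da})
     (\<lambda>(y, x, a) (y', x', a'). reduced_op psi [nx, da, ny, db] {0, 1, 2} M [x, a, y, 0] [x', a', y', 0])"
  unfolding ent_def
  by (subst vn_entropy_reindex[of "{..<ny} \<times> {..<nx} \<times> {..<da}" "\<lambda>(y, x, a). [x, a, y, 0]"], simp, rule bij_betw_sub_basis_four)
     (auto simp: reg_range_def image_iff inj_on_def case_prod_unfold)

lemma ent_YW:
  "ent psi [nx, da, ny, db] {2, 3} {2} =
     (\<Sum>y<ny. vn_entropy {..<db} (\<lambda>b b'. \<Sum>x<nx. \<Sum>a<da. psi [x, a, y, b] * cnj (psi [x, a, y, b'])))"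
  unfolding ent_BW by (rule vn_entropy_blocks) (auto simp: reduced_op_four)

lemma ent_XW:
  "ent psi [nx, da, ny, db] {0, 1} {0} =
     (\<Sum>x<nx. vn_entropy {..<da} (\<lambda>a a'. \<Sum>y<ny. \<Sum>b<db. psi [x, a, y, b] * cnj (psi [x, a', y, b])))"
  unfolding ent_AW by (rule vn_entropy_blocks) (auto simp: reduced_op_four)

lemma ent_BB:
  "ent psi [nx, da, ny, db] {2, 3} {} = vn_entropy ({..<ny} \<times> {..<db})
     (\<lambda>(y, b) (y', b'). \<Sum>(x, a)\<in>{..<nx} \<times> {..<da}. psi [x, a, y, b] * cnj (psi [x, a, y', b']))"
  unfolding ent_BW
  by (rule vn_entropy_cong) (auto simp: reduced_op_four sum.cartesian_product)

lemma ent_AA: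
  "ent psi [nx, da, ny, db] {0, 1} {} = vn_entropy ({..<nx} \<times> {..<da})
     (\<lambda>(x, a) (x', a'). \<Sum>(y, b)\<in>{..<ny} \<times> {..<db}. psi [x, a, y, b] * cnj (psi [x', a', y, b]))"
  unfolding ent_AW
  by (rule vn_entropy_cong) (auto simp: reduced_op_four sum.cartesian_product)

lemma ent_XBB:
  "ent psi [nx, da, ny, db] {0, 2, 3} {0} = (\<Sum>x<nx. vn_entropy ({..<ny} \<times> {..<db})
     (\<lambda>(y, b) (y', b'). \<Sum>a<da. psi [x, a, y, b] * cnj (psi [x, a, y', b'])))"
  unfolding ent_XBW by (rule vn_entropy_blocks) (auto simp: reduced_op_four)

lemma ent_YAA:
  "ent psi [nx, da, ny, db] {0, 1, 2} {2} = (\<Sum>y<ny. vn_entropy ({..<nx} \<times> {..<da})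
     (\<lambda>(x, a) (x', a'). \<Sum>b<db. psi [x, a, y, b] * cnj (psi [x', a', y, b])))"
  unfolding ent_YAW by (rule vn_entropy_blocks) (auto simp: reduced_op_four)

text \<open>With two measured registers the operator is split first along \<open>x\<close> and then
  along \<open>y\<close>.\<close>

lemma ent_XYW:
  "ent psi [nx, da, ny, db] {0, 2, 3} {0, 2} =
     (\<Sum>x<nx. \<Sum>y<ny. vn_entropy {..<db} (\<lambda>b b'. \<Sum>a<da. psi [x, a, y, b] * cnj (psi [x, a, y, b'])))"
proof -
  have "ent psi [nx, da, ny, db] {0, 2, 3} {0, 2} = (\<Sum>x<nx. vn_entropy ({..<ny} \<times> {..<db})
     (\<lambda>(y, b) (y', b'). if y = y' then \<Sum>a<da. psi [x, a, y, b] * cnj (psi [x, a, y', b']) else 0))"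
    unfolding ent_XBW by (rule vn_entropy_blocks) (auto simp: reduced_op_four)
  also have "\<dots> = (\<Sum>x<nx. \<Sum>y<ny. vn_entropy {..<db} (\<lambda>b b'. \<Sum>a<da. psi [x, a, y, b] * cnj (psi [x, a, y, b'])))"
    by (intro sum.cong refl vn_entropy_blocks) auto
  finally show ?thesis .
qed

lemma ent_YXW:
  "ent psi [nx, da, ny, db] {0, 1, 2} {0, 2} =
     (\<Sum>y<ny. \<Sum>x<nx. vn_entropy {..<da} (\<lambda>a a'. \<Sum>b<db. psi [x, a, y, b] * cnj (psi [x, a', y, b])))"
proof -
  have "ent psi [nx, da, ny, db] {0, 1, 2} {0, 2} = (\<Sum>y<ny. vn_entropy ({..<nx} \<times> {..<da})
     (\<lambda>(x, a) (x', a'). if x = x' then \<Sum>b<db. psi [x, a, y, b] * cnj (psi [x', a', y, b]) else 0))"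
    unfolding ent_YAW by (rule vn_entropy_blocks) (auto simp: reduced_op_four)
  also have "\<dots> = (\<Sum>y<ny. \<Sum>x<nx. vn_entropy {..<da} (\<lambda>a a'. \<Sum>b<db. psi [x, a, y, b] * cnj (psi [x, a', y, b])))"
    by (intro sum.cong refl vn_entropy_blocks) auto
  finally show ?thesis .
qed

subsection \<open>Embeddings of Rabin oblivious transfer\<close>

lemma eta_inverse_power: "eta (1 / 2 ^ k) = real k / 2 ^ k"
proof -
  have "\<not> 1 / 2 ^ k \<le> (0 :: real)" by (simp add: not_le)
  then show ?thesis by (simp add: eta_def log_divide log_nat_power)
qed

text \<open>Row \<open>x\<close> of the primitive is supported on \<open>y = x\<close> and on
  \<bottom>, which is encoded as \<open>n\<close>.\<close>

lemma sum_rot_row: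
  fixes F :: "nat \<Rightarrow> 'a :: comm_monoid_add"
  assumes "x < n" "\<And>y. y < n \<Longrightarrow> y \<noteq> x \<Longrightarrow> F y = 0"
  shows "(\<Sum>y<n + 1. F y) = F x + F n"
proof -
  have "(\<Sum>y<n + 1. F y) = (\<Sum>y\<in>{x, n}. F y)"
    by (rule sum.mono_neutral_right) (use assms in auto)
  then show ?thesis using assms(1) by simp
qed

lemma sum_rot_column:
  fixes F :: "nat \<Rightarrow> 'a :: comm_monoid_add"
  assumes "y < n" "\<And>x. x < n \<Longrightarrow> x \<noteq> y \<Longrightarrow> F x = 0"
  shows "(\<Sum>x<n. F x) = F y"
proof -
  have "(\<Sum>x<n. F x) = (\<Sum>x\<in>{y}. F x)"
    by (rule sum.mono_neutral_right) (use assms in auto)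
  then show ?thesis by simp
qed

lemma sum_rot_x: "x < 2 ^ r \<Longrightarrow> (\<Sum>y<2 ^ r + 1. rot r x y) = 1 / 2 ^ r"
  by (subst sum_rot_row[of x]) (auto simp: rot_def)

lemma sum_rot_y: "y < 2 ^ r \<Longrightarrow> (\<Sum>x<2 ^ r. rot r x y) = 1 / 2 ^ (r + 1)"
  by (subst sum_rot_column[of y]) (auto simp: rot_def)

lemma sum_rot_bot: "(\<Sum>x<2 ^ r. rot r x (2 ^ r)) = 1 / 2"
  by (simp add: rot_def)

lemma entropy_rot_x: "(\<Sum>x<2 ^ r. eta (\<Sum>y<2 ^ r + 1. rot r x y)) = r"
proof -
  have "(\<Sum>x<2 ^ r. eta (\<Sum>y<2 ^ r + 1. rot r x y)) = (\<Sum>x<(2 ^ r :: nat). eta (1 / 2 ^ r))"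
    by (intro sum.cong refl arg_cong[of _ _ eta] sum_rot_x) simp
  then show ?thesis by (simp add: eta_inverse_power)
qed

lemma entropy_rot_y: "(\<Sum>y<2 ^ r + 1. eta (\<Sum>x<2 ^ r. rot r x y)) = r / 2 + 1"
proof -
  have "(\<Sum>y<2 ^ r. eta (\<Sum>x<2 ^ r. rot r x y)) = (r + 1) / 2"
    by (simp add: sum_rot_y eta_inverse_power del: power_Suc) simp
  then show ?thesis
    using eta_inverse_power[of 1] by (simp add: sum_rot_bot field_simps)
qed

text \<open>The entropies are \<open>r\<close> for X, \<open>r / 2 + 1\<close> for Y and
  \<open>r + 1\<close> for the pair, which is uniform on \<open>2 * 2 ^ r\<close> values.\<close>

lemma shannon_mi_rot: "shannon_mi (2 ^ r) (2 ^ r + 1) (rot r) = r / 2"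
proof -
  have "(\<Sum>y<2 ^ r + 1. eta (rot r x y)) = 2 * eta (1 / 2 ^ (r + 1))" if "x < 2 ^ r" for x
    using that by (subst sum_rot_row[of x]) (auto simp: rot_def eta_def)
  then have "(\<Sum>x<2 ^ r. \<Sum>y<2 ^ r + 1. eta (rot r x y)) = (\<Sum>x<(2 ^ r :: nat). 2 * eta (1 / 2 ^ (r + 1)))"
    by (intro sum.cong) auto
  also have "\<dots> = r + 1" unfolding eta_inverse_power by simp
  finally show ?thesis unfolding shannon_mi_def entropy_rot_x entropy_rot_y by simp
qed

section \<open>The Fourier basis and the identity plus the all-ones matrix\<close>

definition dft :: "nat \<Rightarrow> nat \<Rightarrow> nat \<Rightarrow> complex" where
  "dft n k x = cis (2 * pi * real k / real n) ^ x / of_real (sqrt n)"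

lemma dft_commute: "dft n k x = dft n x k"
  by (simp add: dft_def DeMoivre mult_ac)

lemma dft_orthonormal:
  assumes n: "n > 0"
  shows "orthonormal_basis {..<n} (dft n)"
proof -
  have inner: "(\<Sum>x<n. cnj (dft n j x) * dft n k x) = (if j = k then 1 else 0)" if jk: "j < n" "k < n" for j k
  proof -
    define w where "w i = cis (2 * pi * real i / real n)" for i
    have w1: "cnj (w i) * w i = 1" for i by (simp add: w_def cis_cnj cis_mult)
    have wn: "w i ^ n = 1" for i
      using n by (simp add: w_def DeMoivre)
    \<comment> \<open>\<open>z\<close> is an \<open>n\<close>-th root of unity that equals 1 only
      for \<open>j = k\<close>; otherwise its geometric sum vanishes.\<close>
    define z where "z = cnj (w j) * w k"
    have zn: "z ^ n = 1" by (simp add: z_def power_mult_distrib wn flip: complex_cnj_power)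
    have "(\<Sum>x<n. cnj (dft n j x) * dft n k x) = (\<Sum>x<n. z ^ x / of_nat n)"
      by (intro sum.cong refl)
         (simp add: dft_def z_def w_def power_mult_distrib flip: of_real_mult)
    also have "\<dots> = (\<Sum>x<n. z ^ x) / of_nat n" by (simp add: sum_divide_distrib)
    finally have eq: "(\<Sum>x<n. cnj (dft n j x) * dft n k x) = (\<Sum>x<n. z ^ x) / of_nat n" .
    show ?thesis
    proof (cases "j = k")
      case True
      then have "z = 1" using w1 by (simp add: z_def)
      then show ?thesis using eq True n by simp
    next
      case False
      have "z \<noteq> 1"
      proof
        assume "z = 1"
        then have "w j * (cnj (w j) * w k) = w j" by (simp add: z_def)
        then have "w k = w j" using w1[of j] by (metis mult.assoc mult.commute mult_1)
        moreover have "inj_on w {..<n}"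
          using bij_betw_roots_unity[OF n] unfolding w_def[abs_def] by (rule bij_betw_imp_inj_on)
        ultimately show False using jk False by (auto simp: inj_on_def)
      qed
      then show ?thesis using eq False geometric_sum[of z n] zn by simp
    qed
  qed
  have "(\<Sum>j<n. dft n j i * cnj (dft n j k)) = (if i = k then 1 else 0)" if "i < n" "k < n" for i k
    using inner[OF that(2,1)] by (auto simp: dft_commute[of n _ i] dft_commute[of n _ k] mult.commute)
  with inner show ?thesis unfolding orthonormal_basis_def by simp
qed

text \<open>The all-ones matrix is \<open>n\<close> times the projection onto the constant vector
  \<open>dft n 0\<close>. Adding the identity gives eigenvalue \<open>n + 1\<close> there and 1 on
  the other Fourier vectors.\<close>

lemma dft_diagonalizes:
  assumes x: "x < n" "x' < n"
  shows "(\<Sum>k<n. (if k = 0 then of_nat n + 1 else 1) * dft n k x * cnj (dft n k x')) =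
         (if x = x' then 2 else 1)"
proof -
  have n: "n > 0" using x by simp
  have "(\<Sum>k<n. (if k = 0 then of_nat n + 1 else 1) * dft n k x * cnj (dft n k x')) =
      (\<Sum>k<n. dft n k x * cnj (dft n k x') + (if k = 0 then 1 else 0) * (of_nat n * (dft n k x * cnj (dft n k x'))))"
    by (intro sum.cong refl) (simp add: algebra_simps)
  also have "\<dots> = (\<Sum>k<n. dft n k x * cnj (dft n k x')) + of_nat n * (dft n 0 x * cnj (dft n 0 x'))"
    using n by (simp only: sum.distrib sum_delta_mult finite_lessThan lessThan_iff)
  also have "of_nat n * (dft n 0 x * cnj (dft n 0 x')) = 1"
    using n by (simp add: dft_def flip: of_real_mult)
  finally show ?thesis
    using dft_orthonormal[OF n] x unfolding orthonormal_basis_def by auto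
qed

section \<open>Operators conditional on a pair of outcomes, and the leakage\<close>

abbreviation (input) nstr :: "nat \<Rightarrow> nat" where "nstr r \<equiv> 2 ^ r"

abbreviation (input) rot_regs :: "nat \<Rightarrow> nat \<Rightarrow> nat \<Rightarrow> nat list" where
  "rot_regs r da db \<equiv> [2 ^ r, da, 2 ^ r + 1, db]"

abbreviation (input) rot_embedding :: "nat \<Rightarrow> nat \<Rightarrow> nat \<Rightarrow> (nat list \<Rightarrow> complex) \<Rightarrow> bool" where
  "rot_embedding r da db psi \<equiv> is_embedding (2 ^ r) (2 ^ r + 1) (rot r) da db psi"

text \<open>The unnormalized reduced operator on A' given the outcomes \<open>x\<close> and
  \<open>y\<close>; for an embedding its trace is the probability of that pair.\<close>

definition alice_op :: "(nat list \<Rightarrow> complex) \<Rightarrow> nat \<Rightarrow> nat \<Rightarrow> nat \<Rightarrow> nat \<Rightarrow> nat \<Rightarrow> complex" where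
  "alice_op psi db x y a a' = (\<Sum>b<db. psi [x, a, y, b] * cnj (psi [x, a', y, b]))"

definition bob_op :: "(nat list \<Rightarrow> complex) \<Rightarrow> nat \<Rightarrow> nat \<Rightarrow> nat \<Rightarrow> nat \<Rightarrow> nat \<Rightarrow> complex" where
  "bob_op psi da x y b b' = (\<Sum>a<da. psi [x, a, y, b] * cnj (psi [x, a, y, b']))"

text \<open>Given both outcomes, the vector on A'B' is pure, so the operator on A' has the same
  entropy.\<close>

definition block_entropy :: "(nat list \<Rightarrow> complex) \<Rightarrow> nat \<Rightarrow> nat \<Rightarrow> nat \<Rightarrow> nat \<Rightarrow> real" where
  "block_entropy psi da db x y = vn_entropy {..<db} (bob_op psi da x y)"

lemma block_entropy_alice_op: "vn_entropy {..<da} (alice_op psi db x y) = block_entropy psi da db x y"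
  unfolding block_entropy_def alice_op_def[abs_def] bob_op_def[abs_def] by (rule vn_entropy_Schmidt) auto

lemma psd_alice_op: "psd_on {..<da} (alice_op psi db x y)"
  unfolding alice_op_def[abs_def] by (rule psd_on_Gram)

lemma psd_bob_op: "psd_on {..<db} (bob_op psi da x y)"
  unfolding bob_op_def[abs_def] by (rule psd_on_Gram)

text \<open>\<open>x = 0\<close> serves as a representative: for an embedding, Bob's operator at
  \<bottom> turns out to be the same for every \<open>x\<close>.\<close>

definition common_op :: "nat \<Rightarrow> (nat list \<Rightarrow> complex) \<Rightarrow> nat \<Rightarrow> nat \<Rightarrow> nat \<Rightarrow> complex" where
  "common_op r psi da = bob_op psi da 0 (nstr r)"

definition common_entropy :: "nat \<Rightarrow> (nat list \<Rightarrow> complex) \<Rightarrow> nat \<Rightarrow> nat \<Rightarrow> real" where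
  "common_entropy r psi da db = block_entropy psi da db 0 (nstr r)"

lemma psd_common_op: "psd_on {..<db} (common_op r psi da)"
  unfolding common_op_def by (rule psd_bob_op)

lemma ent_BB_eq_AA: "ent psi (rot_regs r da db) {2, 3} {} = ent psi (rot_regs r da db) {0, 1} {}"
  unfolding ent_BB ent_AA case_prod_unfold
  by (rule vn_entropy_Schmidt[of _ _ "\<lambda>xa yb. psi [fst xa, snd xa, fst yb, snd yb]", symmetric]) auto

text \<open>Every entropy needed for the leakage reduces to a known number plus a multiple of
  \<open>?h\<close>, the entropy of one block. The multiple is 0 or \<open>2 * ?N\<close>, so
  \<open>?h\<close> cancels from both mutual informations and only \<open>r\<close> remains.\<close>

lemma leakage_value:
  assumes E: "rot_embedding r da db psi"
  shows "leakage (2 ^ r) (2 ^ r + 1) (rot r) da db psi =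
     1 + r / 2 - (2 ^ r + 1) * log 2 (2 ^ r + 1) / (2 * 2 ^ r)"
proof -
  let ?N = "nstr r" and ?dims = "rot_regs r da db" and ?A = "alice_op psi db" and ?B = "bob_op psi da"
    and ?H = "block_entropy psi da db" and ?G = "common_op r psi da" and ?h = "common_entropy r psi da db"
  have amplitudes: "(\<Sum>a<da. \<Sum>b<db. (cmod (psi [x, a, y, b]))\<^sup>2) = rot r x y"
      if asms: "x < ?N" "y < ?N + 1" for x y
    using E asms unfolding is_embedding_def by blast
  have trace_alice_op: "(\<Sum>a<da. ?A x y a a) = of_real (rot r x y)"
      if asms: "x < ?N" "y < ?N + 1" for x y
    unfolding amplitudes[OF asms, symmetric]
    by (simp add: alice_op_def complex_norm_square del: of_real_power)
  have trace_bob_op: "(\<Sum>b<db. ?B x y b b) = of_real (rot r x y)"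
      if asms: "x < ?N" "y < ?N + 1" for x y
    unfolding amplitudes[OF asms, symmetric] bob_op_def
    by (subst sum.swap) (simp add: complex_norm_square del: of_real_power)
  have psi_eq_0: "psi [x, a, y, b] = 0"
      if asms: "x < ?N" "y < ?N" "y \<noteq> x" "a < da" "b < db" for x y a b
  proof -
    have "(\<Sum>a<da. \<Sum>b<db. (cmod (psi [x, a, y, b]))\<^sup>2) = 0"
      using amplitudes[of x y] asms by (simp add: rot_def)
    then have "(\<Sum>b<db. (cmod (psi [x, a, y, b]))\<^sup>2) = 0"
      using asms(4) by (subst (asm) sum_nonneg_eq_0_iff) (auto intro!: sum_nonneg)
    then show ?thesis
      using asms(5) by (subst (asm) sum_nonneg_eq_0_iff) auto
  qed
  have alice_op_eq_0: "x < ?N \<Longrightarrow> y < ?N \<Longrightarrow> y \<noteq> x \<Longrightarrow> a < da \<Longrightarrow> ?A x y a a' = 0" for x y a a'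
    by (simp add: alice_op_def psi_eq_0)
  have bob_op_eq_0: "x < ?N \<Longrightarrow> y < ?N \<Longrightarrow> y \<noteq> x \<Longrightarrow> b < db \<Longrightarrow> ?B x y b b' = 0" for x y b b'
    by (simp add: bob_op_def psi_eq_0)
  have block_entropy_eq_0: "x < ?N \<Longrightarrow> y < ?N \<Longrightarrow> y \<noteq> x \<Longrightarrow> ?H x y = 0" for x y
    unfolding block_entropy_def by (rule vn_entropy_zero) (auto simp: bob_op_eq_0)
  have ent_X_value: "ent psi ?dims {0} {0} = r"
  proof -
    have "(\<Sum>a<da. \<Sum>y<?N + 1. \<Sum>b<db. (cmod (psi [x, a, y, b]))\<^sup>2) = (\<Sum>y<?N + 1. rot r x y)" if "x < ?N" for x
      by (subst sum.swap) (intro sum.cong refl amplitudes, use that in auto)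
    then show ?thesis
      unfolding ent_X using entropy_rot_x[of r] by (metis (no_types, lifting) lessThan_iff sum.cong)
  qed
  have ent_Y_value: "ent psi ?dims {2} {2} = r / 2 + 1"
  proof -
    have "(\<Sum>x<?N. \<Sum>a<da. \<Sum>b<db. (cmod (psi [x, a, y, b]))\<^sup>2) = (\<Sum>x<?N. rot r x y)" if "y < ?N + 1" for y
      by (intro sum.cong refl amplitudes) (use that in auto)
    then show ?thesis
      unfolding ent_Y using entropy_rot_y[of r] by (metis (no_types, lifting) lessThan_iff sum.cong)
  qed
  have sum_block_entropy_row: "x < ?N \<Longrightarrow> (\<Sum>y<?N + 1. ?H x y) = ?H x x + ?H x ?N" for x
    by (rule sum_rot_row) (auto simp: block_entropy_eq_0)
  have bob_op_column: "(\<Sum>x<?N. ?B x y b b') = ?B y y b b'"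
      if asms: "y < ?N" "b < db" for y b b'
    by (rule sum_rot_column) (use asms bob_op_eq_0 in auto)
  have alice_op_row: "(\<Sum>y<?N + 1. ?A x y a a') = ?A x x a a' + ?A x ?N a a'"
      if asms: "x < ?N" "a < da" for x a a'
    by (rule sum_rot_row) (use asms alice_op_eq_0 in auto)
  have ent_XYW_value: "ent psi ?dims {0, 2, 3} {0, 2} = (\<Sum>x<?N. ?H x x + ?H x ?N)"
    unfolding ent_XYW bob_op_def[symmetric] block_entropy_def[symmetric]
    by (intro sum.cong refl sum_block_entropy_row) simp
  have ent_YXW_value: "ent psi ?dims {0, 1, 2} {0, 2} = (\<Sum>x<?N. ?H x x + ?H x ?N)"
    unfolding ent_YXW alice_op_def[symmetric] block_entropy_alice_op
    by (subst sum.swap) (intro sum.cong refl sum_block_entropy_row, simp)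
  have ent_YW_value: "ent psi ?dims {2, 3} {2} = (\<Sum>x<?N. ?H x x) + vn_entropy {..<db} (\<lambda>b b'. \<Sum>x<?N. ?B x ?N b b')"
  proof -
    have "vn_entropy {..<db} (\<lambda>b b'. \<Sum>x<?N. ?B x y b b') = ?H y y" if "y < ?N" for y
      unfolding block_entropy_def by (rule vn_entropy_cong) (use that bob_op_column in auto)
    then show ?thesis
      unfolding ent_YW bob_op_def[symmetric] by simp
  qed
  have ent_XW_value: "ent psi ?dims {0, 1} {0} = (\<Sum>x<?N. vn_entropy {..<da} (\<lambda>a a'. ?A x x a a' + ?A x ?N a a'))"
    unfolding ent_XW alice_op_def[symmetric]
    by (intro sum.cong refl vn_entropy_cong) (use alice_op_row in auto)
  \<comment> \<open>In S(X;YB') the blocks with \<open>y = x\<close> cancel. What remains is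
    equality in \<open>vn_entropy_sum\<close> for the operators at \<bottom>:
    \<open>log 2 ?N = r\<close> times the trace \<open>1 / 2\<close> is the required
    \<open>r / 2\<close>.\<close>
  have bob_op_equal: "?B x ?N b b' = ?B 0 ?N b b'"
      if asms: "x < ?N" "b < db" "b' < db" for x b b'
  proof -
    let ?T = "\<lambda>b b'. \<Sum>x<?N. ?B x ?N b b'"
    have "qmi psi ?dims {0} {0} {2, 3} {2} = r / 2"
      using E unfolding is_embedding_def shannon_mi_rot by simp
    then have "(\<Sum>x<?N. ?H x ?N) = vn_entropy {..<db} ?T + r / 2"
      unfolding qmi_def using ent_XYW_value ent_X_value ent_YW_value
      by (simp add: insert_commute sum.distrib)
    moreover have "Re (\<Sum>b<db. ?T b b) = 1 / 2"
    proof -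
      have "(\<Sum>b<db. ?T b b) = (\<Sum>x<?N. of_real (rot r x ?N))"
        by (subst sum.swap) (intro sum.cong refl trace_bob_op, auto)
      then show ?thesis using sum_rot_bot[of r] by simp
    qed
    ultimately have eq: "(\<Sum>x\<in>{..<?N}. vn_entropy {..<db} (?B x ?N)) =
        vn_entropy {..<db} ?T + log 2 (card {..<?N}) * Re (\<Sum>b<db. ?T b b)"
      by (simp add: block_entropy_def log_nat_power)
    have "?B x ?N b b' = ?T b b' / of_nat (card {..<?N})" if "x < ?N" for x
      by (rule vn_entropy_sum[THEN conjunct2, rule_format, OF _ _ _ _ eq]) (use that asms psd_bob_op in auto)
    from this[OF asms(1)] this[of 0] show ?thesis by simp
  qed
  \<comment> \<open>For each \<open>x\<close> the bound is applied to the two operators at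
    \<open>y = x\<close> and at \<bottom>, with logarithm 1 and trace \<open>1 / ?N\<close>. The
    condition on S(XA';Y) makes the nonnegative deficits sum to zero, so equality holds for each
    \<open>x\<close>.\<close>
  have alice_op_equal: "?A x x a a' = ?A x ?N a a'"
      if asms: "x < ?N" "a < da" "a' < da" for x a a'
  proof -
    let ?S = "\<lambda>x. vn_entropy {..<da} (\<lambda>a a'. ?A x x a a' + ?A x ?N a a')"
    have "qmi psi ?dims {0, 1} {0} {2} {2} = r / 2"
      using E unfolding is_embedding_def shannon_mi_rot by simp
    then have tot: "(\<Sum>x<?N. ?S x + 1 / ?N - (?H x x + ?H x ?N)) = 0"
      unfolding qmi_def using ent_XW_value ent_Y_value ent_YXW_value
      by (simp add: insert_commute sum.distrib sum_subtractf)
    have two: "(\<Sum>k\<in>{x, ?N}. f k) = f x + f ?N" if "x < ?N" for x and f :: "nat \<Rightarrow> 'b :: comm_monoid_add"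
      using that by simp
    have tr: "(\<Sum>a<da. Re (?A x x a a) + Re (?A x ?N a a)) = 1 / ?N" if "x < ?N" for x
      using arg_cong[OF trace_alice_op[of x x], of Re] arg_cong[OF trace_alice_op[of x "?N"], of Re] that
      by (simp add: sum.distrib rot_def)
    have le: "?H x x + ?H x ?N \<le> ?S x + 1 / ?N" if "x < ?N" for x
      using vn_entropy_sum[THEN conjunct1, of "{..<da}" "{x, ?N}" "?A x"] psd_alice_op that
      by (simp add: two tr block_entropy_alice_op)
    have "?S x + 1 / ?N - (?H x x + ?H x ?N) = 0"
      using tot asms(1) by (subst (asm) sum_nonneg_eq_0_iff) (use le in auto)
    then have eq: "(\<Sum>k\<in>{x, ?N}. vn_entropy {..<da} (?A x k)) =
        vn_entropy {..<da} (\<lambda>a a'. \<Sum>k\<in>{x, ?N}. ?A x k a a') +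
        log 2 (card {x, ?N}) * Re (\<Sum>a<da. \<Sum>k\<in>{x, ?N}. ?A x k a a)"
      using asms(1) by (simp add: two tr block_entropy_alice_op)
    have "?A x k a a' = (\<Sum>k\<in>{x, ?N}. ?A x k a a') / of_nat (card {x, ?N})" if "k \<in> {x, ?N}" for k
      by (rule vn_entropy_sum[THEN conjunct2, rule_format, OF _ _ _ _ eq]) (use that asms psd_alice_op in auto)
    from this[of x] this[of "?N"] show ?thesis by simp
  qed
  have bob_op_bot: "x < ?N \<Longrightarrow> b < db \<Longrightarrow> b' < db \<Longrightarrow> ?B x ?N b b' = ?G b b'" for x b b'
    unfolding common_op_def by (rule bob_op_equal)
  have trace_common_op: "Re (\<Sum>b<db. ?G b b) = 1 / (2 * ?N)"
    unfolding common_op_def by (subst trace_bob_op) (auto simp: rot_def)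
  have vn_entropy_scale_common_op: "c > 0 \<Longrightarrow> vn_entropy {..<db} (\<lambda>b b'. of_real c * ?G b b') = c * ?h - c * log 2 c / (2 * ?N)" for c
    using vn_entropy_scale[OF _ psd_common_op[of db r psi da], of c] trace_common_op by (simp add: common_entropy_def block_entropy_def common_op_def)
  have block_entropy_bot: "x < ?N \<Longrightarrow> ?H x ?N = ?h" for x
    unfolding block_entropy_def common_entropy_def by (rule vn_entropy_cong) (auto intro: bob_op_equal)
  \<comment> \<open>The comparison passes through Alice's side, where the two operators coincide; on
    Bob's side they need not.\<close>
  have block_entropy_diag: "?H x x = ?h"
      if asms: "x < ?N" for x
  proof -
    have "?H x x = vn_entropy {..<da} (?A x ?N)"
      unfolding block_entropy_alice_op[symmetric] by (rule vn_entropy_cong) (use asms alice_op_equal in auto)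
    then show ?thesis using asms by (simp add: block_entropy_alice_op block_entropy_bot)
  qed
  \<comment> \<open>Given \<open>x\<close> the state on A'BB' is pure, so the entropy can be taken
    on A'. There the two contributions coincide, and the scaling by 2 costs
    \<open>1 / ?N\<close>.\<close>
  have ent_XBB_value: "ent psi ?dims {0, 2, 3} {0} = 2 * ?N * ?h - 1"
  proof -
    have S: "vn_entropy ({..<?N + 1} \<times> {..<db}) (\<lambda>(y, b) (y', b'). \<Sum>a<da. psi [x, a, y, b] * cnj (psi [x, a, y', b']))
        = 2 * ?h - 1 / ?N" if x: "x < ?N" for x
    proof -
      have "vn_entropy ({..<?N + 1} \<times> {..<db}) (\<lambda>(y, b) (y', b'). \<Sum>a<da. psi [x, a, y, b] * cnj (psi [x, a, y', b']))
        = vn_entropy {..<da} (\<lambda>a a'. \<Sum>yb\<in>{..<?N + 1} \<times> {..<db}.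
             psi [x, a, fst yb, snd yb] * cnj (psi [x, a', fst yb, snd yb]))"
        using vn_entropy_Schmidt[of "{..<?N + 1} \<times> {..<db}" "{..<da}" "\<lambda>yb a. psi [x, a, fst yb, snd yb]"]
        by (simp add: case_prod_unfold)
      also have "\<dots> = vn_entropy {..<da} (\<lambda>a a'. of_real 2 * ?A x ?N a a')"
      proof (rule vn_entropy_cong)
        fix a a' assume a: "a \<in> {..<da}" "a' \<in> {..<da}"
        have "(\<Sum>yb\<in>{..<?N + 1} \<times> {..<db}. psi [x, a, fst yb, snd yb] * cnj (psi [x, a', fst yb, snd yb]))
            = (\<Sum>y<?N + 1. ?A x y a a')"
          by (simp only: alice_op_def sum.cartesian_product case_prod_unfold)
        then show "(\<Sum>yb\<in>{..<?N + 1} \<times> {..<db}. psi [x, a, fst yb, snd yb] * cnj (psi [x, a', fst yb, snd yb]))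
            = of_real 2 * ?A x ?N a a'"
          using alice_op_row[OF x, of a a'] alice_op_equal[OF x, of a a'] a by simp
      qed simp
      also have "\<dots> = 2 * ?h - 1 / ?N"
        using vn_entropy_scale[OF _ psd_alice_op[of da psi db x "?N"], of 2] x
        by (simp add: block_entropy_alice_op block_entropy_bot trace_alice_op rot_def)
      finally show ?thesis .
    qed
    have "ent psi ?dims {0, 2, 3} {0} = (\<Sum>x<?N. 2 * ?h - 1 / ?N)"
      unfolding ent_XBB by (intro sum.cong refl S) simp
    then show ?thesis by (simp add: algebra_simps)
  qed
  \<comment> \<open>Given \<open>y\<close> the state on AA'B' is pure, so the entropy can be taken
    on B'. A string \<open>y\<close> leaves one block; \<bottom> leaves \<open>?N\<close> equal
    ones, and scaling by \<open>?N\<close> costs \<open>r / 2\<close>.\<close>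
  have ent_YAA_value: "ent psi ?dims {0, 1, 2} {2} = 2 * ?N * ?h - r / 2"
  proof -
    have S: "vn_entropy ({..<?N} \<times> {..<da}) (\<lambda>(x, a) (x', a'). \<Sum>b<db. psi [x, a, y, b] * cnj (psi [x', a', y, b]))
        = vn_entropy {..<db} (\<lambda>b b'. \<Sum>x<?N. ?B x y b b')" for y
      using vn_entropy_Schmidt[of "{..<?N} \<times> {..<da}" "{..<db}" "\<lambda>xa b. psi [fst xa, snd xa, y, b]"]
      by (simp add: bob_op_def sum.cartesian_product case_prod_unfold)
    have "vn_entropy {..<db} (\<lambda>b b'. \<Sum>x<?N. ?B x y b b') = ?h" if "y < ?N" for y
      unfolding block_entropy_diag[OF that, symmetric] block_entropy_def by (rule vn_entropy_cong) (use that bob_op_column in auto)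
    moreover have "vn_entropy {..<db} (\<lambda>b b'. \<Sum>x<?N. ?B x ?N b b') = ?N * ?h - r / 2"
    proof -
      have "vn_entropy {..<db} (\<lambda>b b'. \<Sum>x<?N. ?B x ?N b b') = vn_entropy {..<db} (\<lambda>b b'. of_real (real ?N) * ?G b b')"
        by (rule vn_entropy_cong) (simp_all add: bob_op_bot)
      then show ?thesis using vn_entropy_scale_common_op[of "real ?N"] by (simp add: log_nat_power)
    qed
    ultimately show ?thesis unfolding ent_YAA S by simp
  qed
  \<comment> \<open>For distinct \<open>x\<close> and \<open>x'\<close> no string \<open>y\<close>
    is compatible with both, so only \<bottom> contributes; on the diagonal the block
    \<open>y = x\<close> doubles that contribution.\<close>
  have reduced_AA: "(\<Sum>y<?N + 1. \<Sum>b<db. psi [x, a, y, b] * cnj (psi [x', a', y, b])) =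
           (if x = x' then 2 else 1) * (\<Sum>b<db. psi [x, a, ?N, b] * cnj (psi [x', a', ?N, b]))"
      if x: "x < ?N" "x' < ?N" and a: "a < da" "a' < da" for x x' a a'
  proof (cases "x = x'")
    case True
    have "(\<Sum>y<?N + 1. \<Sum>b<db. psi [x, a, y, b] * cnj (psi [x, a', y, b])) = ?A x x a a' + ?A x ?N a a'"
      using alice_op_row[OF x(1) a(1)] by (simp only: alice_op_def)
    then show ?thesis using True alice_op_equal[OF x(1) a] by (simp add: alice_op_def)
  next
    case False
    have "(\<Sum>b<db. psi [x, a, y, b] * cnj (psi [x', a', y, b])) = 0" if "y < ?N" for y
      using that False x a by (intro sum.neutral) (metis complex_cnj_zero lessThan_iff mult_zero_left mult_zero_right psi_eq_0)
    then show ?thesis using False by simp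
  qed
  txt \<open>The Fourier basis diagonalizes the factor \<open>I + J\<close> of the state of Alice.\<close>
  have ent_AA_value: "ent psi ?dims {0, 1} {} = 2 * ?N * ?h - (?N + 1) * log 2 (?N + 1) / (2 * ?N)"
  proof -
    define kap :: "nat \<Rightarrow> complex" where "kap k = (if k = 0 then of_nat ?N + 1 else 1)" for k
    define rho where "rho xa xa' = (\<Sum>yb\<in>{..<?N + 1} \<times> {..<db}.
        psi [fst xa, snd xa, fst yb, snd yb] * cnj (psi [fst xa', snd xa', fst yb, snd yb]))" for xa xa'
    \<comment> \<open>The product in the opposite order is block diagonal: orthonormality separates
      the frequencies, and each block is \<open>kap k\<close> times the conjugate, that is the
      transpose, of Bob's common operator.\<close>
    define tau where "tau kb kb' = (if fst kb = fst kb' then kap (fst kb) * cnj (?G (snd kb) (snd kb')) else 0)"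
      for kb kb' :: "nat \<times> nat"
    have "ent psi ?dims {0, 1} {} = vn_entropy ({..<?N} \<times> {..<da}) rho"
      unfolding ent_AA rho_def[abs_def] by (simp add: case_prod_unfold)
    also have "\<dots> = vn_entropy ({..<?N} \<times> {..<db}) tau"
    proof (rule vn_entropy_factor[where
          A = "\<lambda>xa kb. kap (fst kb) * dft ?N (fst kb) (fst xa) * psi [fst xa, snd xa, ?N, snd kb]" and
          B = "\<lambda>kb xa. cnj (dft ?N (fst kb) (fst xa)) * cnj (psi [fst xa, snd xa, ?N, snd kb])"])
      fix xa xa' assume "xa \<in> {..<?N} \<times> {..<da}" "xa' \<in> {..<?N} \<times> {..<da}"
      then obtain x a x' a' where xa: "xa = (x, a)" "xa' = (x', a')" "x < ?N" "x' < ?N" "a < da" "a' < da" by auto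
      have "rho xa xa' = (\<Sum>y<?N + 1. \<Sum>b<db. psi [x, a, y, b] * cnj (psi [x', a', y, b]))"
        unfolding rho_def xa(1,2) by (simp only: sum.cartesian_product case_prod_unfold fst_conv snd_conv)
      also have "\<dots> = (\<Sum>k<?N. kap k * dft ?N k x * cnj (dft ?N k x')) * (\<Sum>b<db. psi [x, a, ?N, b] * cnj (psi [x', a', ?N, b]))"
        unfolding kap_def dft_diagonalizes[OF xa(3,4)] by (rule reduced_AA[OF xa(3-6)])
      also have "\<dots> = (\<Sum>k<?N. \<Sum>b<db. (kap k * dft ?N k x * psi [x, a, ?N, b]) *
          (cnj (dft ?N k x') * cnj (psi [x', a', ?N, b])))"
        unfolding sum_product by (simp only: mult_ac)
      finally show "rho xa xa' = (\<Sum>kb\<in>{..<?N} \<times> {..<db}.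
          (kap (fst kb) * dft ?N (fst kb) (fst xa) * psi [fst xa, snd xa, ?N, snd kb]) *
          (cnj (dft ?N (fst kb) (fst xa')) * cnj (psi [fst xa', snd xa', ?N, snd kb])))"
        unfolding xa(1,2) by (simp only: sum.cartesian_product case_prod_unfold fst_conv snd_conv)
    next
      fix kb kb' assume "kb \<in> {..<?N} \<times> {..<db}" "kb' \<in> {..<?N} \<times> {..<db}"
      then obtain k b k' b' where kb: "kb = (k, b)" "kb' = (k', b')" "k < ?N" "k' < ?N" "b < db" "b' < db" by auto
      have "(\<Sum>xa\<in>{..<?N} \<times> {..<da}. (cnj (dft ?N k (fst xa)) * cnj (psi [fst xa, snd xa, ?N, b])) *
          (kap k' * dft ?N k' (fst xa) * psi [fst xa, snd xa, ?N, b'])) =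
          (\<Sum>x<?N. \<Sum>a<da. (cnj (dft ?N k x) * cnj (psi [x, a, ?N, b])) * (kap k' * dft ?N k' x * psi [x, a, ?N, b']))"
        by (simp only: sum.cartesian_product case_prod_unfold)
      also have "\<dots> = (\<Sum>x<?N. kap k' * (cnj (dft ?N k x) * dft ?N k' x) * cnj (?B x ?N b b'))"
        by (simp add: bob_op_def sum_distrib_left mult_ac)
      also have "\<dots> = (\<Sum>x<?N. kap k' * (cnj (dft ?N k x) * dft ?N k' x) * cnj (?G b b'))"
        using kb by (intro sum.cong refl) (simp add: bob_op_bot)
      also have "\<dots> = kap k' * (\<Sum>x<?N. cnj (dft ?N k x) * dft ?N k' x) * cnj (?G b b')"
        by (simp only: sum_distrib_left sum_distrib_right)
      also have "\<dots> = tau kb kb'"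
        using dft_orthonormal[of "?N"] kb by (auto simp: orthonormal_basis_def tau_def)
      finally show "tau kb kb' = (\<Sum>xa\<in>{..<?N} \<times> {..<da}.
          (cnj (dft ?N (fst kb) (fst xa)) * cnj (psi [fst xa, snd xa, ?N, snd kb])) *
          (kap (fst kb') * dft ?N (fst kb') (fst xa) * psi [fst xa, snd xa, ?N, snd kb']))"
        by (simp add: kb(1,2))
    qed auto
    also have "\<dots> = (\<Sum>k<?N. vn_entropy {..<db} (\<lambda>b b'. kap k * cnj (?G b b')))"
      by (rule vn_entropy_blocks) (auto simp: tau_def)
    \<comment> \<open>Only the block of frequency 0 is rescaled, by \<open>?N + 1\<close>; the other
      \<open>?N - 1\<close> blocks contribute \<open>?h\<close> each.\<close>
    also have "\<dots> = (\<Sum>k<?N. if k = 0 then (?N + 1) * ?h - (?N + 1) * log 2 (?N + 1) / (2 * ?N) else ?h)"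
    proof (intro sum.cong refl)
      fix k
      have common_op_cnj: "cnj (?G b b') = ?G b' b" for b b'
        by (simp add: common_op_def bob_op_def mult.commute)
      have "vn_entropy {..<db} (\<lambda>b b'. kap k * cnj (?G b b')) = vn_entropy {..<db} (\<lambda>b b'. kap k * ?G b b')"
        unfolding common_op_cnj using vn_entropy_transpose[of "{..<db}" "\<lambda>b b'. kap k * ?G b b'"] by simp
      moreover have "kap k = of_real (if k = 0 then real ?N + 1 else 1)" by (simp add: kap_def)
      ultimately have "vn_entropy {..<db} (\<lambda>b b'. kap k * cnj (?G b b')) =
          vn_entropy {..<db} (\<lambda>b b'. of_real (if k = 0 then real ?N + 1 else 1) * ?G b b')" by simp
      also have "\<dots> = (if k = 0 then real ?N + 1 else 1) * ?h -
          (if k = 0 then real ?N + 1 else 1) * log 2 (if k = 0 then real ?N + 1 else 1) / (2 * ?N)"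
        by (rule vn_entropy_scale_common_op) (simp add: add_nonneg_pos)
      finally show "vn_entropy {..<db} (\<lambda>b b'. kap k * cnj (?G b b')) =
          (if k = 0 then (?N + 1) * ?h - (?N + 1) * log 2 (?N + 1) / (2 * ?N) else ?h)"
        by (simp add: add.commute)
    qed
    also have "\<dots> = (?N + 1) * ?h - (?N + 1) * log 2 (?N + 1) / (2 * ?N) + (?N - 1) * ?h"
    proof -
      have "(\<Sum>k<n. if k = 0 then u else v) = u + real (n - 1) * v" if "n > 0" for u v :: real and n
        using that by (cases n) (simp_all add: sum.lessThan_Suc_shift del: sum.lessThan_Suc)
      then show ?thesis by simp
    qed
    also have "real (?N - 1) = real ?N - 1" by (simp add: of_nat_diff)
    finally show ?thesis by (simp add: algebra_simps)
  qed
  have "{0} \<union> {2, 3} = {0, 2, 3 :: nat}" by auto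
  then have "qmi psi ?dims {0} {0} {2, 3} {} = ent psi ?dims {0} {0} + ent psi ?dims {2, 3} {} - ent psi ?dims {0, 2, 3} {0}"
    by (simp add: qmi_def)
  then have 1: "qmi psi ?dims {0} {0} {2, 3} {} = 1 + r - (2 ^ r + 1) * log 2 (2 ^ r + 1) / (2 * 2 ^ r)"
    unfolding ent_X_value ent_BB_eq_AA ent_AA_value ent_XBB_value by (simp add: add.commute)
  have "{0, 1} \<union> {2} = {0, 1, 2 :: nat}" by auto
  then have "qmi psi ?dims {0, 1} {} {2} {2} = ent psi ?dims {0, 1} {} + ent psi ?dims {2} {2} - ent psi ?dims {0, 1, 2} {2}"
    by (simp add: qmi_def)
  then have 2: "qmi psi ?dims {0, 1} {} {2} {2} = 1 + r - (2 ^ r + 1) * log 2 (2 ^ r + 1) / (2 * 2 ^ r)"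
    unfolding ent_Y_value ent_AA_value ent_YAA_value by (simp add: add.commute)
  show ?thesis unfolding leakage_def shannon_mi_rot using 1 2 by simp
qed

text \<open>\<open>log 2 (n + 1)\<close> exceeds \<open>r\<close> by
  \<open>log 2 (1 + 1 / n)\<close>, which is at most \<open>2 / n\<close> since \<open>ln 2\<close>
  is at least \<open>1 / 2\<close>.\<close>

lemma leakage_bound:
  assumes "r \<ge> 1"
  shows "1 + real r / 2 - (2 ^ r + 1) * log 2 (2 ^ r + 1) / (2 * 2 ^ r) \<ge> 1 - 3 * real r / 2 ^ r"
proof -
  define n where "n = (2 :: real) ^ r"
  have n: "n \<ge> 1" by (simp add: n_def)
  have ln2: "ln (2 :: real) \<ge> 1 / 2" using ln_le_minus_one[of "1 / 2"] by (simp add: ln_div)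
  have "n + 1 = n * (1 + 1 / n)" using n by (simp add: field_simps)
  then have "log 2 (n + 1) = log 2 (n * (1 + 1 / n))" by simp
  also have "\<dots> = log 2 n + log 2 (1 + 1 / n)"
    using n by (intro log_mult_pos) (auto intro: add_pos_nonneg)
  also have "log 2 n = r" by (simp add: n_def log_nat_power)
  also have "log 2 (1 + 1 / n) \<le> 2 / n"
  proof -
    have "ln (1 + 1 / n) \<le> 1 / n" using n by (intro ln_add_one_self_le_self) simp
    also have "\<dots> \<le> 2 / n * ln 2" using ln2 n by (simp add: field_simps)
    finally show ?thesis by (simp add: log_def divide_le_eq)
  qed
  finally have "(n + 1) * log 2 (n + 1) \<le> (n + 1) * (r + 2 / n)"
    using n by (intro mult_left_mono) auto
  also have "\<dots> = n * r + r + 2 + 2 / n" using n by (simp add: field_simps)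
  \<comment> \<open>As \<open>2 / n\<close> is at most 2 and \<open>r\<close> at least 1, the excess
    over \<open>n * r\<close> is at most \<open>r + 4\<close> and hence at most
    \<open>6 * r\<close>; the later division by \<open>2 * n\<close> produces the constant
    3.\<close>
  also have "\<dots> \<le> n * r + 6 * r"
  proof -
    have "2 / n \<le> 2" using n by (simp add: field_simps)
    then show ?thesis using assms by simp
  qed
  finally have "(n + 1) * log 2 (n + 1) / (2 * n) \<le> (n * r + 6 * r) / (2 * n)"
    using n by (intro divide_right_mono) auto
  also have "\<dots> = r / 2 + 3 * r / n" using n by (simp add: field_simps)
  finally show ?thesis by (simp add: n_def)
qed

theorem theorem6:
  shows "(\<exists>C::real. \<forall>r::nat. \<forall>da db psi. r \<ge> 1 \<longrightarrow>
            is_embedding (2^r) (2^r + 1) (rot r) da db psi \<longrightarrow>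
            leakage (2^r) (2^r + 1) (rot r) da db psi \<ge> 1 - C * real r / 2^r)
       \<and> (\<forall>da db psi. is_embedding (2^1) (2^1 + 1) (rot 1) da db psi \<longrightarrow>
            leakage (2^1) (2^1 + 1) (rot 1) da db psi \<ge> binent (1/4) - 1/2)
       \<and> (\<forall>r::nat. \<forall>da1 db1 psi1 da2 db2 psi2. r \<ge> 1 \<longrightarrow>
            is_embedding (2^r) (2^r + 1) (rot r) da1 db1 psi1 \<longrightarrow>
            is_embedding (2^r) (2^r + 1) (rot r) da2 db2 psi2 \<longrightarrow>
            leakage (2^r) (2^r + 1) (rot r) da1 db1 psi1 = leakage (2^r) (2^r + 1) (rot r) da2 db2 psi2)"
proof -
  note leak = leakage_value
  \<comment> \<open>This is exactly the closed value at \<open>r = 1\<close>, so the bound is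
    attained there.\<close>
  have "binent (1 / 4) - 1 / 2 = 3 / 2 - 3 / 4 * log 2 3"
    using eta_inverse_power[of 2] log_nat_power[of 2 2 2]
    by (simp add: binent_def eta_def log_divide algebra_simps)
  then have "leakage (2^1) (2^1 + 1) (rot 1) da db psi \<ge> binent (1/4) - 1/2"
    if "is_embedding (2^1) (2^1 + 1) (rot 1) da db psi" for da db psi
    unfolding leak[OF that] by simp
  moreover have "leakage (2^r) (2^r + 1) (rot r) da db psi \<ge> 1 - 3 * real r / 2^r"
    if "r \<ge> 1" "is_embedding (2^r) (2^r + 1) (rot r) da db psi" for r da db psi
    unfolding leak[OF that(2)] by (rule leakage_bound[OF that(1)])
  moreover have "leakage (2^r) (2^r + 1) (rot r) da1 db1 psi1 = leakage (2^r) (2^r + 1) (rot r) da2 db2 psi2"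
    if "is_embedding (2^r) (2^r + 1) (rot r) da1 db1 psi1" "is_embedding (2^r) (2^r + 1) (rot r) da2 db2 psi2"
    for r da1 db1 psi1 da2 db2 psi2
    using leak[OF that(1)] leak[OF that(2)] by simp
  ultimately show ?thesis by blast
qed

end
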